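(* Let $n\ge1$, let $p\le q$ be positive integers, $N=p+q$, $\mu\in\mathbb{C}$, and let $\xi$ be a partition with at most $N$ parts such that $a=\mu q+\frac{|\xi|+n}{N}$ and $b=-\mu p+\frac{|\xi|+n}{N}$ are nonnegative integers. Let $T\in\mathrm{Tab}(\varphi^{\xi}_{n,p,\mu})$ and let $v_T$ be the corresponding basis element of $F_{n,p,\mu}(V^\xi)=(V^{\xi}\otimes V^{\otimes n})^{\mathfrak{t}_0,\mu}$. Then for each $k=1,\dots,n$, $v_T$ is an eigenvector of $y_k$ with eigenvalue $$-\mathrm{cont}_T(k)+\mathfrak{s},\qquad \mathfrak{s}=\frac{|\xi|+n}{N}+\frac{\mu q-\mu p}{2}-\frac{N}{2}.$$
   Context: Functor. $V=\mathbb{C}^N$ is the vector representation of $\mathfrak{gl}_N$, $V^\xi$ the irreducible polynomial module of highest weight $\xi$. $\mathfrak{t}=\mathfrak{gl}_p\times\mathfrak{gl}_q$ (block diagonal), $\mathfrak{t}_0\subset\mathfrak{t}$ the traceless elements, $\chi(\mathrm{diag}(S,T))=q\,\mathrm{tr}(S)-p\,\mathrm{tr}(T)$. For a $\mathfrak{gl}_N$-module $M$, $F_{n,p,\mu}(M)=(M\otimes V^{\otimes n})^{\mathfrak{t}_0,\mu}=\{v: Av=\mu\chi(A)v\ \forall A\in\mathfrak{t}_0\}$. On it: $s_i$ ($1\le i\le n-1$) exchanges the $i$-th and $(i+1)$-th tensor factors ($M$ being the $0$-th factor); $\gamma_k$ multiplies the $k$-th factor by $J=\mathrm{diag}(I_p,-I_q)$;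 $$y_1=-\sum_{s|t}(E_s^t)_0\otimes(E_t^s)_1+\frac{p-q-\mu N}{2}\gamma_1+\frac12\sum_{l>1}s_{1,l}+\frac12\sum_{l>1}s_{1,l}\gamma_1\gamma_l,$$ where $E_s^t$ is the matrix unit with $(s,t)$ entry $1$, subscripts indicate the tensor factor acted on, $s_{1,l}$ exchanges factors $1$ and $l$, and $\sum_{s|t}=\sum_{s=1}^p\sum_{t=p+1}^N+\sum_{t=1}^p\sum_{s=p+1}^N$; and $y_k=s_{k-1}y_{k-1}s_{k-1}-s_{k-1}$ for $k\ge2$. Tableaux. $\nu/\xi=\{(i,j)\in\mathbb{Z}^2:\xi_i<j\le\nu_i\}$. $\mathrm{Tab}(\varphi^{\xi}_{n,p,\mu})$ is the set of standard tableaux $T:\{1,\dots,n\}\to\nu/\xi$ (bijections increasing along rows and down columns), where $\nu$ runs over partitions with at most $N$ parts with $\xi\subset\nu$, $|\nu|=|\xi|+n$, $\nu_i+\nu_{N-i+1}=a+b$ for $1\le i\le p$, $\nu_p\ge\max(a,b)$, and $\nu_i=b$ for $p+1\le i\le q$. If $T(k)=(i,j)$ then $\mathrm{cont}_T(k)=j-i$. The vector $v_T$. Put $\nu^{(k)}=\xi\cup T(\{1,\dots,k\})$ for $0\le k\le n$. The vectors of $(V^\xi\otimes V^{\otimes n})^{\mathfrak{t}_0,\mu}$ lying, for every $k=1,\dots,n$, in $(V^\xi\otimes V^{\otimes k})[\nu^{(k)}]\otimes V^{\otimes(n-k)}$, where $X[\nu^{(k)}]$ is the $V^{\nu^{(k)}}$-isotypic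 component of $X$, form a one-dimensional space; $v_T$ is a nonzero vector in it, and $\{v_T\}_{T\in \mathrm{Tab}(\varphi^{\xi}_{n,p,\mu})}$ is a basis of $F_{n,p,\mu}(V^\xi)$. *)

theory Defs
  imports
    Complex_Main
    "HOL-Library.Function_Algebras"
    "HOL-Library.FuncSet"
    "HOL-Combinatorics.Transposition"
    "Jordan_Normal_Form.Matrix"
begin

section \<open>Partitions and tableaux\<close>

text \<open>A partition is given by its parts \<open>\<lambda> 1 \<ge> \<lambda> 2 \<ge> \<dots>\<close>; the unused value \<open>\<lambda> 0\<close> is fixed to be \<open>0\<close>.\<close>

definition partition_at_most :: "nat \<Rightarrow> (nat \<Rightarrow> nat) \<Rightarrow> bool" where
  "partition_at_most N lam \<longleftrightarrow>
     lam 0 = 0 \<and> (\<forall>i\<ge>1. lam (Suc i) \<le> lam i) \<and> (\<forall>i>N. lam i = 0)"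

text \<open>The size of a partition with at most \<open>N\<close> parts.\<close>

definition psize :: "nat \<Rightarrow> (nat \<Rightarrow> nat) \<Rightarrow> nat" where
  "psize N lam = (\<Sum>i=1..N. lam i)"

definition diagram :: "(nat \<Rightarrow> nat) \<Rightarrow> (nat \<times> nat) set" where
  "diagram lam = {(i, j). 1 \<le> i \<and> 1 \<le> j \<and> j \<le> lam i}"

definition skew_diagram :: "(nat \<Rightarrow> nat) \<Rightarrow> (nat \<Rightarrow> nat) \<Rightarrow> (nat \<times> nat) set" where
  "skew_diagram nu xi = {(i, j). xi i < j \<and> j \<le> nu i}"

definition row_lengths :: "(nat \<times> nat) set \<Rightarrow> nat \<Rightarrow> nat" where
  "row_lengths D i = card {j. (i, j) \<in> D}"

text \<open>Tableaux are functions on \<open>{1..n}\<close>, extended by \<open>undefined\<close>.\<close>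

definition standard_tableaux :: "nat \<Rightarrow> (nat \<times> nat) set \<Rightarrow> (nat \<Rightarrow> nat \<times> nat) set" where
  "standard_tableaux n D =
     {T \<in> extensional {1..n}. bij_betw T {1..n} D \<and>
        (\<forall>k\<in>{1..n}. \<forall>l\<in>{1..n}. fst (T k) = fst (T l) \<and> snd (T k) < snd (T l) \<longrightarrow> k < l) \<and>
        (\<forall>k\<in>{1..n}. \<forall>l\<in>{1..n}. snd (T k) = snd (T l) \<and> fst (T k) < fst (T l) \<longrightarrow> k < l)}"

definition admissible_shape ::
    "nat \<Rightarrow> nat \<Rightarrow> nat \<Rightarrow> nat \<Rightarrow> nat \<Rightarrow> (nat \<Rightarrow> nat) \<Rightarrow> (nat \<Rightarrow> nat) \<Rightarrow> bool" where
  "admissible_shape p q n a b xi nu \<longleftrightarrow>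
     partition_at_most (p + q) nu \<and>
     (\<forall>i. xi i \<le> nu i) \<and>
     psize (p + q) nu = psize (p + q) xi + n \<and>
     (\<forall>i\<in>{1..p}. nu i + nu (p + q - i + 1) = a + b) \<and>
     nu p \<ge> max a b \<and>
     (\<forall>i\<in>{p + 1..q}. nu i = b)"

definition Tab :: "nat \<Rightarrow> nat \<Rightarrow> nat \<Rightarrow> nat \<Rightarrow> nat \<Rightarrow> (nat \<Rightarrow> nat) \<Rightarrow> (nat \<Rightarrow> nat \<times> nat) set" where
  "Tab p q n a b xi =
     (\<Union>nu\<in>{nu. admissible_shape p q n a b xi nu}. standard_tableaux n (skew_diagram nu xi))"

definition cont :: "(nat \<Rightarrow> nat \<times> nat) \<Rightarrow> nat \<Rightarrow> int" where
  "cont T k = int (snd (T k)) - int (fst (T k))"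

definition partial_shape :: "(nat \<Rightarrow> nat) \<Rightarrow> (nat \<Rightarrow> nat \<times> nat) \<Rightarrow> nat \<Rightarrow> nat \<Rightarrow> nat" where
  "partial_shape xi T k = row_lengths (diagram xi \<union> T ` {1..k})"

section \<open>Modules over the general linear Lie algebra\<close>

text \<open>
  The Lie algebra of rank \<open>N\<close> is the space \<open>carrier_mat N N\<close> of complex matrices with the
  commutator bracket. As usual for these matrices, rows and columns are numbered from \<open>0\<close>, while
  parts of partitions are numbered from \<open>1\<close>. A module is a subspace \<open>M\<close> of an ambient complex
  vector space, so that submodules are modules for the same \<open>scale\<close> and \<open>\<rho>\<close>.
\<close>

definition matrix_unit :: "nat \<Rightarrow> nat \<Rightarrow> nat \<Rightarrow> complex mat" where
  "matrix_unit N s t = mat N N (\<lambda>(i, j). if i = s \<and> j = t then 1 else 0)"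

definition mat_trace :: "complex mat \<Rightarrow> complex" where
  "mat_trace A = (\<Sum>i<dim_row A. A $$ (i, i))"

definition block_diag :: "complex mat \<Rightarrow> complex mat \<Rightarrow> complex mat" where
  "block_diag S T =
     four_block_mat S (0\<^sub>m (dim_row S) (dim_col T)) (0\<^sub>m (dim_row T) (dim_col S)) T"

locale gl_module = vector_space scale
  for scale :: "complex \<Rightarrow> 'v::ab_group_add \<Rightarrow> 'v" +
  fixes N :: nat and \<rho> :: "complex mat \<Rightarrow> 'v \<Rightarrow> 'v" and M :: "'v set"
  assumes subspace_carrier: "subspace M"
    and act_closed: "A \<in> carrier_mat N N \<Longrightarrow> x \<in> M \<Longrightarrow> \<rho> A x \<in> M"
    and act_add: "A \<in> carrier_mat N N \<Longrightarrow> x \<in> M \<Longrightarrow> y \<in> M \<Longrightarrow> \<rho> A (x + y) = \<rho> A x + \<rho> A y"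
    and act_scale: "A \<in> carrier_mat N N \<Longrightarrow> x \<in> M \<Longrightarrow> \<rho> A (scale c x) = scale c (\<rho> A x)"
    and add_act: "A \<in> carrier_mat N N \<Longrightarrow> B \<in> carrier_mat N N \<Longrightarrow> x \<in> M \<Longrightarrow>
      \<rho> (A + B) x = \<rho> A x + \<rho> B x"
    and smult_act: "A \<in> carrier_mat N N \<Longrightarrow> x \<in> M \<Longrightarrow> \<rho> (c \<cdot>\<^sub>m A) x = scale c (\<rho> A x)"
    and bracket_act: "A \<in> carrier_mat N N \<Longrightarrow> B \<in> carrier_mat N N \<Longrightarrow> x \<in> M \<Longrightarrow>
      \<rho> (A * B - B * A) x = \<rho> A (\<rho> B x) - \<rho> B (\<rho> A x)"

definition irreducible_gl_module ::
    "(complex \<Rightarrow> 'v::ab_group_add \<Rightarrow> 'v) \<Rightarrow> nat \<Rightarrow> (complex mat \<Rightarrow> 'v \<Rightarrow> 'v) \<Rightarrow> 'v set \<Rightarrow> bool" where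
  "irreducible_gl_module scale N \<rho> M \<longleftrightarrow>
     gl_module scale N \<rho> M \<and> M \<noteq> {0} \<and>
     (\<forall>S\<subseteq>M. gl_module scale N \<rho> S \<longrightarrow> S = {0} \<or> S = M)"

definition highest_weight_vector ::
    "(complex \<Rightarrow> 'v::ab_group_add \<Rightarrow> 'v) \<Rightarrow> nat \<Rightarrow> (complex mat \<Rightarrow> 'v \<Rightarrow> 'v) \<Rightarrow> (nat \<Rightarrow> nat) \<Rightarrow> 'v \<Rightarrow> bool" where
  "highest_weight_vector scale N \<rho> lam v \<longleftrightarrow>
     v \<noteq> 0 \<and>
     (\<forall>i<N. \<rho> (matrix_unit N i i) v = scale (of_nat (lam (Suc i))) v) \<and>
     (\<forall>i j. i < j \<and> j < N \<longrightarrow> \<rho> (matrix_unit N i j) v = 0)"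

text \<open>
  \<open>highest_weight_irrep scale N \<rho> M lam\<close> says that \<open>M\<close> is a copy of \<open>V\<^sup>\<lambda>\<close>, the finite-dimensional
  irreducible module of highest weight \<open>\<lambda>\<close>, which determines it up to isomorphism. It is
  polynomial because the entries of \<open>\<lambda>\<close> are nonnegative integers.
\<close>

definition highest_weight_irrep ::
    "(complex \<Rightarrow> 'v::ab_group_add \<Rightarrow> 'v) \<Rightarrow> nat \<Rightarrow> (complex mat \<Rightarrow> 'v \<Rightarrow> 'v) \<Rightarrow> 'v set \<Rightarrow> (nat \<Rightarrow> nat) \<Rightarrow> bool" where
  "highest_weight_irrep scale N \<rho> M lam \<longleftrightarrow>
     irreducible_gl_module scale N \<rho> M \<and>
     (\<exists>B. finite B \<and> module.span scale B = M) \<and>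
     (\<exists>v\<in>M. highest_weight_vector scale N \<rho> lam v)"

text \<open>The sum of all submodules of \<open>X\<close> isomorphic to \<open>V\<^sup>\<lambda>\<close>.\<close>

definition isotypic_component ::
    "(complex \<Rightarrow> 'v::ab_group_add \<Rightarrow> 'v) \<Rightarrow> nat \<Rightarrow> (complex mat \<Rightarrow> 'v \<Rightarrow> 'v) \<Rightarrow> 'v set \<Rightarrow> (nat \<Rightarrow> nat) \<Rightarrow> 'v set" where
  "isotypic_component scale N \<rho> X lam =
     module.span scale (\<Union>{S. S \<subseteq> X \<and> highest_weight_irrep scale N \<rho> S lam})"

section \<open>The tensor product of a module with copies of the vector representation\<close>

text \<open>
  Let \<open>e\<^sub>0, \<dots>, e\<^bsub>N-1\<^esub>\<close> be the standard basis of \<open>V = \<complex>\<^sup>N\<close>. The tensor product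
  \<open>M \<otimes> V\<^sup>\<otimes>\<^sup>n\<close> is modelled by the functions from words to \<open>M\<close>: the function \<open>f\<close> stands for the
  sum of \<open>f w \<otimes> e\<^bsub>w 1\<^esub> \<otimes> \<dots> \<otimes> e\<^bsub>w n\<^esub>\<close> over all words \<open>w\<close>. Outside of words \<open>f\<close> is \<open>0\<close>.
\<close>

definition words :: "nat \<Rightarrow> nat \<Rightarrow> (nat \<Rightarrow> nat) set" where
  "words N n = {1..n} \<rightarrow>\<^sub>E {..<N}"

definition tensor_space :: "nat \<Rightarrow> nat \<Rightarrow> 'm::ab_group_add set \<Rightarrow> ((nat \<Rightarrow> nat) \<Rightarrow> 'm) set" where
  "tensor_space N n M = {f. (\<forall>w\<in>words N n. f w \<in> M) \<and> (\<forall>w. w \<notin> words N n \<longrightarrow> f w = 0)}"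

definition fscale :: "(complex \<Rightarrow> 'm \<Rightarrow> 'm) \<Rightarrow> complex \<Rightarrow> ('w \<Rightarrow> 'm) \<Rightarrow> 'w \<Rightarrow> 'm" where
  "fscale scale c f = (\<lambda>w. scale c (f w))"

definition act_factor0 ::
    "nat \<Rightarrow> nat \<Rightarrow> (complex mat \<Rightarrow> 'm::ab_group_add \<Rightarrow> 'm) \<Rightarrow> complex mat \<Rightarrow> ((nat \<Rightarrow> nat) \<Rightarrow> 'm) \<Rightarrow> (nat \<Rightarrow> nat) \<Rightarrow> 'm" where
  "act_factor0 N n \<rho> A f = (\<lambda>w. if w \<in> words N n then \<rho> A (f w) else 0)"

text \<open>The matrix \<open>A\<close> acting on the \<open>k\<close>-th copy of \<open>V\<close>, for \<open>1 \<le> k \<le> n\<close>, by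
  \<open>A e\<^sub>j = (\<Sum>i<N. A $$ (i, j) e\<^sub>i)\<close>.\<close>

definition act_factor ::
    "(complex \<Rightarrow> 'm::ab_group_add \<Rightarrow> 'm) \<Rightarrow> nat \<Rightarrow> nat \<Rightarrow> nat \<Rightarrow> complex mat \<Rightarrow> ((nat \<Rightarrow> nat) \<Rightarrow> 'm) \<Rightarrow> (nat \<Rightarrow> nat) \<Rightarrow> 'm" where
  "act_factor scale N n k A f =
     (\<lambda>w. if w \<in> words N n then \<Sum>j<N. scale (A $$ (w k, j)) (f (w(k := j))) else 0)"

definition tensor_act ::
    "(complex \<Rightarrow> 'm::ab_group_add \<Rightarrow> 'm) \<Rightarrow> nat \<Rightarrow> nat \<Rightarrow> (complex mat \<Rightarrow> 'm \<Rightarrow> 'm) \<Rightarrow> complex mat \<Rightarrow> ((nat \<Rightarrow> nat) \<Rightarrow> 'm) \<Rightarrow> (nat \<Rightarrow> nat) \<Rightarrow> 'm" where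
  "tensor_act scale N n \<rho> A f = act_factor0 N n \<rho> A f + (\<Sum>k=1..n. act_factor scale N n k A f)"

text \<open>The exchange of the \<open>k\<close>-th and \<open>l\<close>-th copies of \<open>V\<close>.\<close>

definition swap_factors :: "nat \<Rightarrow> nat \<Rightarrow> ((nat \<Rightarrow> nat) \<Rightarrow> 'm) \<Rightarrow> (nat \<Rightarrow> nat) \<Rightarrow> 'm" where
  "swap_factors k l f = (\<lambda>w. f (w \<circ> transpose k l))"

text \<open>
  Regard \<open>M \<otimes> V\<^sup>\<otimes>\<^sup>n\<close> as the tensor product of \<open>X = M \<otimes> V\<^sup>\<otimes>\<^sup>k\<close> with \<open>V\<^sup>\<otimes>\<^sup>(\<^sup>n\<^sup>-\<^sup>k\<^sup>)\<close>. The coefficient in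
  \<open>X\<close> of \<open>f\<close> at the basis vector of the last \<open>n - k\<close> factors given by a word \<open>u\<close> on
  \<open>{k+1..n}\<close> is \<open>left_coefficient N k f u\<close>, so that the elements of \<open>U \<otimes> V\<^sup>\<otimes>\<^sup>(\<^sup>n\<^sup>-\<^sup>k\<^sup>)\<close>, for a
  subspace \<open>U\<close> of \<open>X\<close>, are those with all coefficients in \<open>U\<close>.
\<close>

definition left_coefficient ::
    "nat \<Rightarrow> nat \<Rightarrow> ((nat \<Rightarrow> nat) \<Rightarrow> 'm::ab_group_add) \<Rightarrow> (nat \<Rightarrow> nat) \<Rightarrow> (nat \<Rightarrow> nat) \<Rightarrow> 'm" where
  "left_coefficient N k f u = (\<lambda>w. if w \<in> words N k then f (override_on u w {1..k}) else 0)"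

definition extend_subspace ::
    "nat \<Rightarrow> nat \<Rightarrow> nat \<Rightarrow> 'm set \<Rightarrow> ((nat \<Rightarrow> nat) \<Rightarrow> 'm::ab_group_add) set \<Rightarrow> ((nat \<Rightarrow> nat) \<Rightarrow> 'm) set" where
  "extend_subspace N k n M U =
     {f \<in> tensor_space N n M. \<forall>u\<in>{k + 1..n} \<rightarrow>\<^sub>E {..<N}. left_coefficient N k f u \<in> U}"

section \<open>The functor and its operators\<close>

definition F_space ::
    "(complex \<Rightarrow> 'm::ab_group_add \<Rightarrow> 'm) \<Rightarrow> nat \<Rightarrow> nat \<Rightarrow> nat \<Rightarrow> complex \<Rightarrow> (complex mat \<Rightarrow> 'm \<Rightarrow> 'm) \<Rightarrow> 'm set \<Rightarrow> ((nat \<Rightarrow> nat) \<Rightarrow> 'm) set" where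
  "F_space scale p q n \<mu> \<rho> M =
     {v \<in> tensor_space (p + q) n M.
        \<forall>S\<in>carrier_mat p p. \<forall>T\<in>carrier_mat q q.
          mat_trace (block_diag S T) = 0 \<longrightarrow>
          tensor_act scale (p + q) n \<rho> (block_diag S T) v =
            fscale scale (\<mu> * (of_nat q * mat_trace S - of_nat p * mat_trace T)) v}"

definition J_mat :: "nat \<Rightarrow> nat \<Rightarrow> complex mat" where
  "J_mat p q = block_diag (1\<^sub>m p) (- 1\<^sub>m q)"

definition gamma_op ::
    "(complex \<Rightarrow> 'm::ab_group_add \<Rightarrow> 'm) \<Rightarrow> nat \<Rightarrow> nat \<Rightarrow> nat \<Rightarrow> nat \<Rightarrow> ((nat \<Rightarrow> nat) \<Rightarrow> 'm) \<Rightarrow> (nat \<Rightarrow> nat) \<Rightarrow> 'm" where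
  "gamma_op scale p q n k = act_factor scale (p + q) n k (J_mat p q)"

text \<open>The operator \<open>(E\<^sub>s\<^sup>t)\<^sub>0 \<otimes> (E\<^sub>t\<^sup>s)\<^sub>1\<close>, where \<open>E\<^sub>s\<^sup>t\<close> has its entry \<open>1\<close> at \<open>(s, t)\<close>.\<close>

definition EE_op ::
    "(complex \<Rightarrow> 'm::ab_group_add \<Rightarrow> 'm) \<Rightarrow> nat \<Rightarrow> nat \<Rightarrow> (complex mat \<Rightarrow> 'm \<Rightarrow> 'm) \<Rightarrow> nat \<Rightarrow> nat \<Rightarrow> ((nat \<Rightarrow> nat) \<Rightarrow> 'm) \<Rightarrow> (nat \<Rightarrow> nat) \<Rightarrow> 'm" where
  "EE_op scale N n \<rho> s t f =
     act_factor0 N n \<rho> (matrix_unit N s t) (act_factor scale N n 1 (matrix_unit N t s) f)"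

definition y1_op ::
    "(complex \<Rightarrow> 'm::ab_group_add \<Rightarrow> 'm) \<Rightarrow> nat \<Rightarrow> nat \<Rightarrow> nat \<Rightarrow> complex \<Rightarrow> (complex mat \<Rightarrow> 'm \<Rightarrow> 'm) \<Rightarrow> ((nat \<Rightarrow> nat) \<Rightarrow> 'm) \<Rightarrow> (nat \<Rightarrow> nat) \<Rightarrow> 'm" where
  "y1_op scale p q n \<mu> \<rho> f =
     - ((\<Sum>s<p. \<Sum>t=p..<p + q. EE_op scale (p + q) n \<rho> s t f) +
        (\<Sum>t<p. \<Sum>s=p..<p + q. EE_op scale (p + q) n \<rho> s t f))
     + fscale scale ((of_nat p - of_nat q - \<mu> * of_nat (p + q)) / 2) (gamma_op scale p q n 1 f)
     + fscale scale (1 / 2) (\<Sum>l=2..n. swap_factors 1 l f)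
     + fscale scale (1 / 2)
         (\<Sum>l=2..n. swap_factors 1 l (gamma_op scale p q n 1 (gamma_op scale p q n l f)))"

text \<open>Only the indices \<open>1, \<dots>, n\<close> are meaningful; the value at index \<open>0\<close> is a dummy.\<close>

fun y_op ::
    "(complex \<Rightarrow> 'm::ab_group_add \<Rightarrow> 'm) \<Rightarrow> nat \<Rightarrow> nat \<Rightarrow> nat \<Rightarrow> complex \<Rightarrow> (complex mat \<Rightarrow> 'm \<Rightarrow> 'm) \<Rightarrow> nat \<Rightarrow> ((nat \<Rightarrow> nat) \<Rightarrow> 'm) \<Rightarrow> (nat \<Rightarrow> nat) \<Rightarrow> 'm" where
  "y_op scale p q n \<mu> \<rho> 0 f = 0"
| "y_op scale p q n \<mu> \<rho> (Suc 0) f = y1_op scale p q n \<mu> \<rho> f"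
| "y_op scale p q n \<mu> \<rho> (Suc (Suc k)) f =
     swap_factors (Suc k) (Suc (Suc k))
       (y_op scale p q n \<mu> \<rho> (Suc k) (swap_factors (Suc k) (Suc (Suc k)) f))
     - swap_factors (Suc k) (Suc (Suc k)) f"

text \<open>The line of vectors from which the basis vector \<open>v\<^sub>T\<close> is chosen, up to a nonzero scalar.\<close>

definition tableau_line ::
    "(complex \<Rightarrow> 'm::ab_group_add \<Rightarrow> 'm) \<Rightarrow> nat \<Rightarrow> nat \<Rightarrow> nat \<Rightarrow> complex \<Rightarrow> (complex mat \<Rightarrow> 'm \<Rightarrow> 'm) \<Rightarrow> 'm set \<Rightarrow> (nat \<Rightarrow> nat) \<Rightarrow> (nat \<Rightarrow> nat \<times> nat) \<Rightarrow> ((nat \<Rightarrow> nat) \<Rightarrow> 'm) set" where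
  "tableau_line scale p q n \<mu> \<rho> M xi T =
     {v \<in> F_space scale p q n \<mu> \<rho> M. \<forall>k\<in>{1..n}.
        v \<in> extend_subspace (p + q) k n M
              (isotypic_component (fscale scale) (p + q) (tensor_act scale (p + q) k \<rho>)
                 (tensor_space (p + q) k M) (partial_shape xi T k))}"

definition is_eigenvector :: "(complex \<Rightarrow> 'v \<Rightarrow> 'v) \<Rightarrow> ('v \<Rightarrow> 'v) \<Rightarrow> 'v::zero \<Rightarrow> complex \<Rightarrow> bool" where
  "is_eigenvector scale f v c \<longleftrightarrow> v \<noteq> 0 \<and> f v = scale c v"

end

theory Submission
  imports Defs
begin

text \<open>
  The operators \<open>y\<^sub>k\<close> turn out to be, up to a shift, Jucys--Murphy operators. Write \<open>\<Omega>\<^sub>k\<close> for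
  \<open>\<Sum>\<^bsub>s,t\<^esub> (E\<^sub>s\<^sup>t)\<^sub>0 \<otimes> (E\<^sub>t\<^sup>s)\<^sub>k\<close>, the sum over all indices \<open>s, t\<close>. On a vector \<open>v\<close> of the space
  \<open>F\<close>, the element \<open>E\<^sub>s\<^sup>t\<close> with \<open>s\<close> and \<open>t\<close> in the same block acts on the whole tensor product by \<open>0\<close> if
  \<open>s \<noteq> t\<close>, and by \<open>a\<close> or \<open>b\<close> according to the block if \<open>s = t\<close>. Here the traceless condition
  is completed by the action of the identity matrix, which is \<open>\<bar>\<xi>\<bar> + n\<close>. This determines the part
  of \<open>\<Omega>\<^sub>1 v\<close> coming from pairs in the same block, and all the \<open>\<gamma>\<close>-terms of \<open>y\<^sub>1\<close> cancel:
  \<open>y\<^sub>1 v = \<ss> v - \<Omega>\<^sub>1 v\<close>. As \<open>F\<close> is stable under the exchanges of factors, the recursion for \<open>y\<^sub>k\<close>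
  gives \<open>y\<^sub>k v = \<ss> v - (\<Omega>\<^sub>k + \<Sum>\<^bsub>l<k\<^esub> s\<^bsub>l,k\<^esub>) v\<close> (lemma \<open>y_op_block_weight_vector\<close>).

  Let \<open>C\<^sub>k\<close> be the Casimir operator \<open>\<Sum>\<^bsub>s,t\<^esub> E\<^sub>s\<^sup>t E\<^sub>t\<^sup>s\<close> acting on the factors \<open>0, \<dots>, k\<close>. Expanding it
  shows \<open>C\<^sub>k - C\<^bsub>k-1\<^esub> = N + 2 (\<Omega>\<^sub>k + \<Sum>\<^bsub>l<k\<^esub> s\<^bsub>l,k\<^esub>)\<close> (lemma \<open>partial_casimir_Suc\<close>). On a
  copy of \<open>V\<^sup>\<nu>\<close> the Casimir operator is the scalar \<open>\<Sum>\<^sub>i \<nu>\<^sub>i (\<nu>\<^sub>i + N + 1 - 2 i)\<close>, which is read off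
  on a highest weight vector. So \<open>C\<^sub>k\<close> and \<open>C\<^bsub>k-1\<^esub>\<close> act on \<open>v\<^sub>T\<close> by scalars, and adding the
  box \<open>(i, j)\<close> to a partition increases this scalar by \<open>N + 2 (j - i)\<close>
  (lemma \<open>casimir_value_add_box\<close>). Hence \<open>\<Omega>\<^sub>k + \<Sum>\<^bsub>l<k\<^esub> s\<^bsub>l,k\<^esub>\<close> acts on \<open>v\<^sub>T\<close> by the content of the
  \<open>k\<close>-th box.
\<close>

section \<open>Matrix units and the Casimir operator\<close>

lemma matrix_unit_carrier [simp]: "matrix_unit N s t \<in> carrier_mat N N"
  by (simp add: matrix_unit_def)

lemma matrix_unit_index [simp]:
  "i < N \<Longrightarrow> j < N \<Longrightarrow> matrix_unit N s t $$ (i, j) = (if i = s \<and> j = t then 1 else 0)"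
  by (simp add: matrix_unit_def)

lemma matrix_unit_mult:
  assumes "t < N"
  shows "matrix_unit N s t * matrix_unit N u v = (if t = u then matrix_unit N s v else 0\<^sub>m N N)"
proof (rule eq_matI)
  fix i j assume "i < dim_row (if t = u then matrix_unit N s v else 0\<^sub>m N N)"
    "j < dim_col (if t = u then matrix_unit N s v else 0\<^sub>m N N)"
  then have ij: "i < N" "j < N" by (auto simp: matrix_unit_def split: if_splits)
  have "(matrix_unit N s t * matrix_unit N u v) $$ (i, j)
      = (\<Sum>k<N. (if i = s \<and> k = t then 1 else 0) * (if k = u \<and> j = v then 1 else 0))"
    using ij by (simp add: matrix_unit_def scalar_prod_def lessThan_atLeast0)
  also have "\<dots> = (\<Sum>k<N. if k = t then (if i = s \<and> t = u \<and> j = v then 1 else 0) else 0)"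
    by (intro sum.cong) auto
  also have "\<dots> = (if i = s \<and> t = u \<and> j = v then 1 else 0)"
    using assms by simp
  finally show "(matrix_unit N s t * matrix_unit N u v) $$ (i, j)
      = (if t = u then matrix_unit N s v else 0\<^sub>m N N) $$ (i, j)"
    using ij by simp
qed (auto simp: matrix_unit_def)

text \<open>The Casimir operator \<open>\<Sum>\<^bsub>s,t\<^esub> E\<^sub>s\<^sup>t E\<^sub>t\<^sup>s\<close> of the general linear Lie algebra in a module.\<close>

definition casimir :: "nat \<Rightarrow> (complex mat \<Rightarrow> 'v \<Rightarrow> 'v) \<Rightarrow> 'v \<Rightarrow> 'v::ab_group_add" where
  "casimir N \<rho> x = (\<Sum>s<N. \<Sum>t<N. \<rho> (matrix_unit N s t) (\<rho> (matrix_unit N t s) x))"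

text \<open>
  The eigenvalue of the Casimir operator on the irreducible module of highest weight \<open>lam\<close>, with
  the parts of \<open>lam\<close> numbered from \<open>1\<close>.
\<close>

definition casimir_value :: "nat \<Rightarrow> (nat \<Rightarrow> nat) \<Rightarrow> complex" where
  "casimir_value N lam =
     (\<Sum>i=1..N. of_nat (lam i) * (of_nat (lam i) + of_nat N + 1 - 2 * of_nat i))"

context gl_module
begin

abbreviation unit_act :: "nat \<Rightarrow> nat \<Rightarrow> 'v \<Rightarrow> 'v" where
  "unit_act s t \<equiv> \<rho> (matrix_unit N s t)"

lemma zero_in_carrier [simp]: "0 \<in> M"
  by (rule subspace_0[OF subspace_carrier])

lemma act_zero [simp]: "A \<in> carrier_mat N N \<Longrightarrow> \<rho> A 0 = 0"
  using act_scale[of A 0 0] by simp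

lemma act_sum:
  assumes "A \<in> carrier_mat N N" and "\<And>i. i \<in> I \<Longrightarrow> f i \<in> M"
  shows "\<rho> A (\<Sum>i\<in>I. f i) = (\<Sum>i\<in>I. \<rho> A (f i))"
  using assms(2)
proof (induction I rule: infinite_finite_induct)
  case (insert i I)
  then have "sum f I \<in> M" by (intro subspace_sum[OF subspace_carrier]) auto
  with insert show ?case by (simp add: act_add[OF assms(1)])
qed (use assms(1) in auto)

lemma zero_act: "x \<in> M \<Longrightarrow> \<rho> (0\<^sub>m N N) x = 0"
  using smult_act[of "0\<^sub>m N N" x 0] by simp

lemma diff_act:
  assumes "A \<in> carrier_mat N N" "B \<in> carrier_mat N N" "x \<in> M"
  shows "\<rho> (A - B) x = \<rho> A x - \<rho> B x"
proof -
  have "A - B = A + (-1) \<cdot>\<^sub>m B" using assms by (intro eq_matI) auto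
  then show ?thesis using assms by (simp add: add_act smult_act)
qed

lemma diff_closed: "x \<in> M \<Longrightarrow> y \<in> M \<Longrightarrow> x - y \<in> M"
  by (rule subspace_diff[OF subspace_carrier])

lemma act_diff:
  assumes "A \<in> carrier_mat N N" "x \<in> M" "y \<in> M"
  shows "\<rho> A (x - y) = \<rho> A x - \<rho> A y"
  using act_add[OF assms(1) diff_closed[OF assms(2,3)] assms(3)] by (simp add: algebra_simps)

lemma unit_act_closed [simp]: "x \<in> M \<Longrightarrow> unit_act s t x \<in> M"
  by (simp add: act_closed)

lemma unit_act_commutator:
  assumes "a < N" "b < N" "s < N" "t < N" "x \<in> M"
  shows "unit_act a b (unit_act s t x) = unit_act s t (unit_act a b x)
    + ((if b = s then unit_act a t x else 0) - (if t = a then unit_act s b x else 0))"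
proof -
  have "unit_act a b (unit_act s t x) - unit_act s t (unit_act a b x)
      = \<rho> (matrix_unit N a b * matrix_unit N s t - matrix_unit N s t * matrix_unit N a b) x"
    using assms by (simp add: bracket_act)
  also have "\<dots> = \<rho> (matrix_unit N a b * matrix_unit N s t) x - \<rho> (matrix_unit N s t * matrix_unit N a b) x"
    using assms by (intro diff_act mult_carrier_mat[of _ N N _ N]) auto
  also have "\<dots> = (if b = s then unit_act a t x else 0) - (if t = a then unit_act s b x else 0)"
    using assms by (simp add: matrix_unit_mult zero_act)
  finally show ?thesis by (simp add: algebra_simps)
qed

text \<open>The action is determined by the matrix units. The proof adds the entries one at a time.\<close>

lemma act_expand:
  assumes "A \<in> carrier_mat N N" and x: "x \<in> M"
  shows "\<rho> A x = (\<Sum>i<N. \<Sum>j<N. scale (A $$ (i, j)) (unit_act i j x))"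
proof -
  define mask where "mask F = mat N N (\<lambda>ij. if ij \<in> F then A $$ ij else 0)" for F
  have mask_carrier: "mask F \<in> carrier_mat N N" for F by (simp add: mask_def)
  have "\<rho> (mask F) x = (\<Sum>(i, j)\<in>F. scale (A $$ (i, j)) (unit_act i j x))"
    if "finite F" "F \<subseteq> {..<N} \<times> {..<N}" for F
    using that
  proof (induction F)
    case empty
    have "mask {} = 0\<^sub>m N N" by (intro eq_matI) (auto simp: mask_def)
    then show ?case by (simp add: zero_act x)
  next
    case (insert ij F)
    obtain i j where ij: "ij = (i, j)" by fastforce
    have "mask (insert ij F) = A $$ (i, j) \<cdot>\<^sub>m matrix_unit N i j + mask F"
      using insert ij by (intro eq_matI) (auto simp: mask_def matrix_unit_def)
    then show ?case
      using insert by (simp add: add_act smult_act mask_carrier x ij)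
  qed
  from this[of "{..<N} \<times> {..<N}"] have "\<rho> (mask ({..<N} \<times> {..<N})) x
      = (\<Sum>i<N. \<Sum>j<N. scale (A $$ (i, j)) (unit_act i j x))"
    by (simp add: sum.cartesian_product)
  moreover have "mask ({..<N} \<times> {..<N}) = A"
    using assms(1) by (intro eq_matI) (auto simp: mask_def)
  ultimately show ?thesis by simp
qed

lemma casimir_closed: "x \<in> M \<Longrightarrow> casimir N \<rho> x \<in> M"
  unfolding casimir_def by (intro subspace_sum[OF subspace_carrier] unit_act_closed)

lemma casimir_add: "x \<in> M \<Longrightarrow> y \<in> M \<Longrightarrow> casimir N \<rho> (x + y) = casimir N \<rho> x + casimir N \<rho> y"
  by (simp add: casimir_def act_add sum.distrib)

lemma casimir_scale: "x \<in> M \<Longrightarrow> casimir N \<rho> (scale c x) = scale c (casimir N \<rho> x)"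
  by (simp add: casimir_def act_scale scale_sum_right)

lemma casimir_unit_act:
  assumes a: "a < N" and b: "b < N" and x: "x \<in> M"
  shows "casimir N \<rho> (unit_act a b x) = unit_act a b (casimir N \<rho> x)"
proof -
  have step: "unit_act a b (unit_act s t (unit_act t s x)) =
      unit_act s t (unit_act t s (unit_act a b x))
      + (((if b = t then unit_act s t (unit_act a s x) else 0)
          - (if s = a then unit_act s t (unit_act t b x) else 0))
        + ((if b = s then unit_act a t (unit_act t s x) else 0)
          - (if t = a then unit_act s b (unit_act t s x) else 0)))"
    if "s < N" "t < N" for s t
  proof -
    have "unit_act a b (unit_act s t (unit_act t s x))
      = unit_act s t (unit_act a b (unit_act t s x))
        + ((if b = s then unit_act a t (unit_act t s x) else 0)
          - (if t = a then unit_act s b (unit_act t s x) else 0))"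
      using that a b x by (subst unit_act_commutator) auto
    also have "unit_act a b (unit_act t s x) = unit_act t s (unit_act a b x)
        + ((if b = t then unit_act a s x else 0) - (if s = a then unit_act t b x else 0))"
      using that a b x by (subst unit_act_commutator) auto
    also have "unit_act s t \<dots> = unit_act s t (unit_act t s (unit_act a b x))
       + ((if b = t then unit_act s t (unit_act a s x) else 0)
          - (if s = a then unit_act s t (unit_act t b x) else 0))"
      using x by (subst act_add) (auto simp: act_diff diff_closed simp del: diff_0 diff_0_right)
    finally show ?thesis by (simp add: add.assoc)
  qed
  have "unit_act a b (casimir N \<rho> x) = (\<Sum>s<N. \<Sum>t<N. unit_act a b (unit_act s t (unit_act t s x)))"
    unfolding casimir_def using x
    by (subst act_sum; simp add: subspace_sum[OF subspace_carrier] act_sum)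
  also have "\<dots> = (\<Sum>s<N. \<Sum>t<N. unit_act s t (unit_act t s (unit_act a b x))
      + (((if b = t then unit_act s t (unit_act a s x) else 0)
          - (if s = a then unit_act s t (unit_act t b x) else 0))
        + ((if b = s then unit_act a t (unit_act t s x) else 0)
          - (if t = a then unit_act s b (unit_act t s x) else 0))))"
    by (intro sum.cong refl step) auto
  also have "\<dots> = casimir N \<rho> (unit_act a b x)
      + (((\<Sum>s<N. \<Sum>t<N. if b = t then unit_act s t (unit_act a s x) else 0)
          - (\<Sum>s<N. \<Sum>t<N. if s = a then unit_act s t (unit_act t b x) else 0))
        + ((\<Sum>s<N. \<Sum>t<N. if b = s then unit_act a t (unit_act t s x) else 0)
          - (\<Sum>s<N. \<Sum>t<N. if t = a then unit_act s b (unit_act t s x) else 0)))"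
    by (simp only: sum.distrib sum_subtractf casimir_def)
  also have "(\<Sum>s<N. \<Sum>t<N. if b = t then unit_act s t (unit_act a s x) else 0)
      = (\<Sum>s<N. unit_act s b (unit_act a s x))" using b by simp
  also have "(\<Sum>s<N. \<Sum>t<N. if t = a then unit_act s b (unit_act t s x) else 0)
      = (\<Sum>s<N. unit_act s b (unit_act a s x))" using a by simp
  also have "(\<Sum>s<N. \<Sum>t<N. if s = a then unit_act s t (unit_act t b x) else 0)
      = (\<Sum>t<N. unit_act a t (unit_act t b x))" using a by (subst sum.swap) simp
  also have "(\<Sum>s<N. \<Sum>t<N. if b = s then unit_act a t (unit_act t s x) else 0)
      = (\<Sum>t<N. unit_act a t (unit_act t b x))" using b by (subst sum.swap) simp
  finally show ?thesis by simp
qed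

lemma casimir_act:
  assumes A: "A \<in> carrier_mat N N" and x: "x \<in> M"
  shows "casimir N \<rho> (\<rho> A x) = \<rho> A (casimir N \<rho> x)"
proof -
  have "casimir N \<rho> 0 = 0" by (simp add: casimir_def)
  then have sum: "casimir N \<rho> (\<Sum>i\<in>I. f i) = (\<Sum>i\<in>I. casimir N \<rho> (f i))"
    if "\<And>i. i \<in> I \<Longrightarrow> f i \<in> M" for f :: "nat \<Rightarrow> 'v" and I
    using that
  proof (induction I rule: infinite_finite_induct)
    case (insert i I)
    then have "sum f I \<in> M" by (intro subspace_sum[OF subspace_carrier]) auto
    with insert show ?case by (simp add: casimir_add)
  qed auto
  show ?thesis
    using x
    by (simp add: act_expand[OF A] sum subspace_sum[OF subspace_carrier]
        subspace_scale[OF subspace_carrier] casimir_scale casimir_unit_act casimir_closed)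
qed

text \<open>
  The form of Schur's lemma needed here: no finiteness is required, because one eigenvector is
  given and its eigenspace is a submodule.
\<close>

lemma irreducible_central_operator:
  assumes irr: "irreducible_gl_module scale N \<rho> M"
    and add: "\<And>x y. x \<in> M \<Longrightarrow> y \<in> M \<Longrightarrow> \<phi> (x + y) = \<phi> x + \<phi> y"
    and scal: "\<And>c x. x \<in> M \<Longrightarrow> \<phi> (scale c x) = scale c (\<phi> x)"
    and comm: "\<And>A x. A \<in> carrier_mat N N \<Longrightarrow> x \<in> M \<Longrightarrow> \<phi> (\<rho> A x) = \<rho> A (\<phi> x)"
    and v: "v \<in> M" "v \<noteq> 0" "\<phi> v = scale c v"
    and x: "x \<in> M"
  shows "\<phi> x = scale c x"
proof -
  let ?S = "{y \<in> M. \<phi> y = scale c y}"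
  have "\<phi> 0 = 0" using scal[of 0 0] by simp
  then have "subspace ?S"
    using subspace_carrier
    by (auto simp: subspace_def add scal scale_right_distrib scale_left_commute)
  then have "gl_module scale N \<rho> ?S"
    by unfold_locales
      (auto simp: act_closed comm act_scale act_add add_act smult_act bracket_act)
  moreover have "\<forall>S\<subseteq>M. gl_module scale N \<rho> S \<longrightarrow> S = {0} \<or> S = M"
    using irr unfolding irreducible_gl_module_def by (elim conjE)
  ultimately have "?S = {0} \<or> ?S = M" by (metis (no_types, lifting) mem_Collect_eq subsetI)
  moreover have "v \<in> ?S" using v by simp
  ultimately have "?S = M" using v(2) by (metis (no_types, lifting) singletonD)
  with x have "x \<in> ?S" by simp
  then show ?thesis by simp
qed

text \<open>
  For \<open>s < t\<close> the product \<open>E\<^sub>s\<^sup>t E\<^sub>t\<^sup>s\<close> acts on a highest weight vector as the commutator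
  \<open>E\<^sub>s\<^sup>s - E\<^sub>t\<^sup>t\<close>, and for \<open>s > t\<close> it acts by \<open>0\<close>.
\<close>

lemma casimir_highest_weight_vector:
  assumes v: "v \<in> M" and hw: "highest_weight_vector scale N \<rho> lam v"
  shows "casimir N \<rho> v = scale (casimir_value N lam) v"
proof -
  let ?l = "\<lambda>i. of_nat (lam (Suc i)) :: complex"
  have diag: "unit_act i i v = scale (?l i) v" if "i < N" for i
    using hw that by (simp add: highest_weight_vector_def)
  have up: "unit_act i j v = 0" if "i < j" "j < N" for i j
    using hw that by (simp add: highest_weight_vector_def)
  have entry: "unit_act s t (unit_act t s v)
      = scale ((if s = t then ?l s * ?l s else 0) + (if s < t then ?l s - ?l t else 0)) v"
    if "s < N" "t < N" for s t
  proof (cases s t rule: linorder_cases)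
    case less
    with unit_act_commutator[of s t t s v] that v show ?thesis
      by (simp add: up diag scale_left_diff_distrib)
  next
    case equal
    then show ?thesis using that v by (simp add: diag act_scale)
  next
    case greater
    then show ?thesis using that v by (simp add: up)
  qed
  have "casimir N \<rho> v = scale (\<Sum>s<N. \<Sum>t<N. (if s = t then ?l s * ?l s else 0)
      + (if s < t then ?l s - ?l t else 0)) v"
    by (simp add: casimir_def entry scale_sum_left)
  also have "(\<Sum>s<N. \<Sum>t<N. (if s = t then ?l s * ?l s else 0) + (if s < t then ?l s - ?l t else 0))
     = (\<Sum>s<N. ?l s * ?l s) + ((\<Sum>s<N. \<Sum>t<N. if s < t then ?l s else 0)
        - (\<Sum>s<N. \<Sum>t<N. if s < t then ?l t else 0))"
  proof -
    have "(if s < t then ?l s - ?l t else 0)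
       = (if s < t then ?l s else 0) - (if s < t then ?l t else 0)" for s t by simp
    then show ?thesis by (simp add: sum.distrib sum_subtractf)
  qed
  also have "(\<Sum>s<N. \<Sum>t<N. if s < t then ?l s else 0) = (\<Sum>s<N. ?l s * of_nat (N - Suc s))"
  proof (intro sum.cong refl)
    fix s assume "s \<in> {..<N}"
    have "(\<Sum>t<N. if s < t then ?l s else 0) = (\<Sum>t\<in>{..<N} \<inter> {t. s < t}. ?l s)"
      by (simp add: sum.If_cases)
    also have "{..<N} \<inter> {t. s < t} = {s<..<N}" by auto
    finally show "(\<Sum>t<N. if s < t then ?l s else 0) = ?l s * of_nat (N - Suc s)"
      by (simp add: mult.commute)
  qed
  also have "(\<Sum>s<N. \<Sum>t<N. if s < t then ?l t else 0) = (\<Sum>t<N. ?l t * of_nat t)"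
  proof (subst sum.swap, intro sum.cong refl)
    fix t assume t: "t \<in> {..<N}"
    have "(\<Sum>s<N. if s < t then ?l t else 0) = (\<Sum>s\<in>{..<N} \<inter> {s. s < t}. ?l t)"
      by (simp add: sum.If_cases)
    also have "{..<N} \<inter> {s. s < t} = {..<t}" using t by auto
    finally show "(\<Sum>s<N. if s < t then ?l t else 0) = ?l t * of_nat t"
      by (simp add: mult.commute)
  qed
  also have "(\<Sum>s<N. ?l s * ?l s) + ((\<Sum>s<N. ?l s * of_nat (N - Suc s)) - (\<Sum>t<N. ?l t * of_nat t))
     = (\<Sum>s<N. ?l s * (?l s + of_nat N + 1 - 2 * of_nat (Suc s)))"
    unfolding sum_subtractf[symmetric] sum.distrib[symmetric]
    by (intro sum.cong) (auto simp: of_nat_diff algebra_simps)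
  also have "\<dots> = casimir_value N lam"
    unfolding casimir_value_def by (rule sum.reindex_bij_witness[of _ "\<lambda>i. i - 1" Suc]) auto
  finally show ?thesis .
qed

end

lemma casimir_highest_weight_irrep:
  assumes "highest_weight_irrep scale N \<rho> M lam" and "x \<in> M"
  shows "casimir N \<rho> x = scale (casimir_value N lam) x"
proof -
  from assms(1) obtain v where irr: "irreducible_gl_module scale N \<rho> M"
    and v: "v \<in> M" "highest_weight_vector scale N \<rho> lam v"
    unfolding highest_weight_irrep_def by blast
  from irr interpret gl_module scale N \<rho> M by (simp add: irreducible_gl_module_def)
  from v(2) have "v \<noteq> 0" by (simp add: highest_weight_vector_def)
  show ?thesis
    by (rule irreducible_central_operator[where \<phi> = "casimir N \<rho>", OF irr casimir_add
          casimir_scale casimir_act v(1) \<open>v \<noteq> 0\<close> casimir_highest_weight_vector[OF v] assms(2)])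
qed

lemma identity_highest_weight_irrep:
  assumes "highest_weight_irrep scale N \<rho> M lam" and "x \<in> M"
  shows "\<rho> (1\<^sub>m N) x = scale (of_nat (psize N lam)) x"
proof -
  from assms(1) obtain v where irr: "irreducible_gl_module scale N \<rho> M"
    and v: "v \<in> M" "highest_weight_vector scale N \<rho> lam v"
    unfolding highest_weight_irrep_def by blast
  from irr interpret gl_module scale N \<rho> M by (simp add: irreducible_gl_module_def)
  from v(2) have "v \<noteq> 0" by (simp add: highest_weight_vector_def)
  have diag: "unit_act i i v = scale (of_nat (lam (Suc i))) v" if "i < N" for i
    using v(2) that by (simp add: highest_weight_vector_def)
  have one: "scale (1\<^sub>m N $$ (i, j)) (unit_act i j v) = (if i = j then unit_act i j v else 0)"
    if "i \<in> {..<N}" "j \<in> {..<N}" for i j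
    using that by simp
  have "\<rho> (1\<^sub>m N) v = (\<Sum>i<N. \<Sum>j<N. if i = j then unit_act i j v else 0)"
    by (subst act_expand[OF _ v(1)])
      (simp, intro sum.cong refl, simp add: one)
  also have "\<dots> = scale (\<Sum>i<N. of_nat (lam (Suc i))) v"
    by (simp add: diag scale_sum_left)
  also have "(\<Sum>i<N. of_nat (lam (Suc i)) :: complex) = of_nat (psize N lam)"
    unfolding psize_def of_nat_sum by (rule sum.reindex_bij_witness[of _ "\<lambda>i. i - 1" Suc]) auto
  finally have eig: "\<rho> (1\<^sub>m N) v = scale (of_nat (psize N lam)) v" .
  have comm: "\<rho> (1\<^sub>m N) (\<rho> A y) = \<rho> A (\<rho> (1\<^sub>m N) y)" if "A \<in> carrier_mat N N" "y \<in> M" for A y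
    using bracket_act[of "1\<^sub>m N" A y] that by (simp add: zero_act)
  show ?thesis
    by (rule irreducible_central_operator[where \<phi> = "\<rho> (1\<^sub>m N)" and v = v])
      (use irr act_add act_scale comm v(1) \<open>v \<noteq> 0\<close> eig assms(2) in simp_all)
qed

section \<open>The Casimir operator on the tensor product\<close>

lemma sum_fun_apply: "(\<Sum>i\<in>I. F i) x = (\<Sum>i\<in>I. F i x)"
  by (induction I rule: infinite_finite_induct) auto

lemma words_less: "w \<in> words N n \<Longrightarrow> l \<in> {1..n} \<Longrightarrow> w l < N"
  by (auto simp: words_def)

lemma words_update: "w \<in> words N n \<Longrightarrow> l \<in> {1..n} \<Longrightarrow> t < N \<Longrightarrow> w(l := t) \<in> words N n"
  by (auto simp: words_def PiE_iff extensional_def)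

lemma words_transpose:
  assumes "k \<in> {1..n}" "l \<in> {1..n}"
  shows "w \<circ> transpose k l \<in> words N n \<longleftrightarrow> w \<in> words N n"
proof -
  have imp: "w \<circ> transpose k l \<in> words N n" if "w \<in> words N n" for w
    using that assms by (auto simp: words_def PiE_iff extensional_def transpose_def)
  show ?thesis
    using imp[of w] imp[of "w \<circ> transpose k l"] by (auto simp: comp_assoc)
qed

lemma tensor_space_memD: "f \<in> tensor_space N n M \<Longrightarrow> w \<in> words N n \<Longrightarrow> f w \<in> M"
  by (simp add: tensor_space_def)

lemma tensor_space_outside: "f \<in> tensor_space N n M \<Longrightarrow> w \<notin> words N n \<Longrightarrow> f w = 0"
  by (simp add: tensor_space_def)

lemma swap_tensor_space:
  assumes "k \<in> {1..n}" "l \<in> {1..n}" "f \<in> tensor_space N n M"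
  shows "swap_factors k l f \<in> tensor_space N n M"
  using assms by (auto simp: tensor_space_def swap_factors_def words_transpose)

lemma fscale_apply: "fscale scale c f w = scale c (f w)"
  by (simp add: fscale_def)

lemma vector_space_fscale:
  assumes "vector_space scale"
  shows "vector_space (fscale scale)"
proof -
  interpret vector_space scale by fact
  show ?thesis
    by unfold_locales
      (auto simp: fscale_def fun_eq_iff scale_right_distrib scale_left_distrib)
qed

text \<open>
  The operator \<open>\<Omega>\<^sub>k = \<Sum>\<^bsub>s,t\<^esub> (E\<^sub>s\<^sup>t)\<^sub>0 \<otimes> (E\<^sub>t\<^sup>s)\<^sub>k\<close>. At a word \<open>w\<close> only the terms with \<open>t = w k\<close>
  contribute. Its values at functions that are not words are irrelevant.
\<close>

definition mixed_casimir :: "nat \<Rightarrow> (complex mat \<Rightarrow> 'm \<Rightarrow> 'm) \<Rightarrow> nat \<Rightarrow> ((nat \<Rightarrow> nat) \<Rightarrow> 'm) \<Rightarrow> (nat \<Rightarrow> nat) \<Rightarrow> 'm::ab_group_add" where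
  "mixed_casimir N \<rho> k f w = (\<Sum>s<N. \<rho> (matrix_unit N s (w k)) (f (w(k := s))))"

context gl_module
begin

lemma scale_two: "scale 2 x = x + x"
  using scale_left_distrib[of 1 1 x] by simp

lemma tensor_act_outside: "w \<notin> words N n \<Longrightarrow> tensor_act scale N n \<rho> A f w = 0"
  by (simp add: tensor_act_def act_factor0_def act_factor_def sum_fun_apply)

lemma tensor_act_apply:
  "w \<in> words N n \<Longrightarrow> tensor_act scale N n \<rho> A f w
    = \<rho> A (f w) + (\<Sum>l=1..n. \<Sum>j<N. scale (A $$ (w l, j)) (f (w(l := j))))"
  by (simp add: tensor_act_def act_factor0_def act_factor_def sum_fun_apply)

lemma unit_sum:
  assumes "i < N" "t < N"
  shows "(\<Sum>j<N. scale (matrix_unit N s t $$ (i, j)) (g j)) = (if i = s then g t else 0)"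
proof -
  have "(\<Sum>j<N. scale (matrix_unit N s t $$ (i, j)) (g j))
      = (\<Sum>j<N. if j = t then (if i = s then g j else 0) else 0)"
    using assms(1) by (intro sum.cong) auto
  then show ?thesis using assms(2) by simp
qed

lemma tensor_act_unit:
  assumes "w \<in> words N n" "t < N"
  shows "tensor_act scale N n \<rho> (matrix_unit N s t) f w
    = unit_act s t (f w) + (\<Sum>l=1..n. if w l = s then f (w(l := t)) else 0)"
  unfolding tensor_act_apply[OF assms(1)]
  by (intro arg_cong2[of _ _ _ _ "(+)"] sum.cong[OF refl] refl unit_sum
      words_less[OF assms(1)] assms(2))

text \<open>
  The square of the total action splits into the Casimir operator of \<open>M\<close>, twice the \<open>\<Omega>\<^sub>l\<close>, the
  scalar \<open>N\<close> for each copy of \<open>V\<close>, and the exchange \<open>s\<^bsub>l,m\<^esub>\<close> for each ordered pair of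
  different copies of \<open>V\<close>.
\<close>

lemma casimir_tensor_act:
  assumes f: "f \<in> tensor_space N n M" and w: "w \<in> words N n"
  shows "casimir N (tensor_act scale N n \<rho>) f w
    = casimir N \<rho> (f w) + scale 2 (\<Sum>l=1..n. mixed_casimir N \<rho> l f w)
      + scale (of_nat (N * n)) (f w)
      + (\<Sum>l=1..n. \<Sum>m\<in>{1..n} - {l}. f (w \<circ> transpose l m))"
proof -
  have fM: "f w' \<in> M" if "w' \<in> words N n" for w'
    using f that by (rule tensor_space_memD)
  have wM: "f (w(l := t)) \<in> M" if "l \<in> {1..n}" "t < N" for l t
    using fM words_update[OF w] that by simp
  \<comment> \<open>\<open>?B\<close>: first \<open>E\<^sub>t\<^sup>s\<close> on a copy of \<open>V\<close>, then \<open>E\<^sub>s\<^sup>t\<close> on \<open>M\<close>. \<open>?C\<close>: the other way round.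
    \<open>?D\<close>: both matrix units on copies of \<open>V\<close>.\<close>
  let ?B = "\<lambda>s t. \<Sum>m=1..n. if w m = t then unit_act s t (f (w(m := s))) else 0"
  let ?C = "\<lambda>s t. \<Sum>l=1..n. if w l = s then unit_act t s (f (w(l := t))) else 0"
  let ?D = "\<lambda>s t. \<Sum>l=1..n. if w l = s then
     (\<Sum>m=1..n. if (w(l := t)) m = t then f (w(l := t, m := s)) else 0) else 0"
  have entry: "tensor_act scale N n \<rho> (matrix_unit N s t)
        (tensor_act scale N n \<rho> (matrix_unit N t s) f) w
      = unit_act s t (unit_act t s (f w)) + ?B s t + (?C s t + ?D s t)"
    if st: "s < N" "t < N" for s t
  proof -
    have "unit_act s t (tensor_act scale N n \<rho> (matrix_unit N t s) f w)
      = unit_act s t (unit_act t s (f w) + (\<Sum>m=1..n. if w m = t then f (w(m := s)) else 0))"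
      using w st by (simp add: tensor_act_unit)
    also have "\<dots> = unit_act s t (unit_act t s (f w)) +
        (\<Sum>m=1..n. unit_act s t (if w m = t then f (w(m := s)) else 0))"
      using fM[OF w] wM st
      by (subst act_add) (auto intro!: subspace_sum[OF subspace_carrier] act_sum)
    also have "(\<Sum>m=1..n. unit_act s t (if w m = t then f (w(m := s)) else 0)) = ?B s t"
      by (intro sum.cong) auto
    finally have 1: "unit_act s t (tensor_act scale N n \<rho> (matrix_unit N t s) f w)
      = unit_act s t (unit_act t s (f w)) + ?B s t" .
    have "(\<Sum>l=1..n. if w l = s then tensor_act scale N n \<rho> (matrix_unit N t s) f (w(l := t)) else 0)
       = ?C s t + ?D s t"
      unfolding sum.distrib[symmetric]
      using w st by (intro sum.cong) (auto simp: tensor_act_unit words_update)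
    with 1 show ?thesis using w st by (simp add: tensor_act_unit)
  qed
  have B: "(\<Sum>s<N. \<Sum>t<N. ?B s t) = (\<Sum>l=1..n. mixed_casimir N \<rho> l f w)"
  proof -
    have "(\<Sum>s<N. \<Sum>t<N. ?B s t) = (\<Sum>s<N. \<Sum>m=1..n. \<Sum>t<N. if w m = t then unit_act s t (f (w(m := s))) else 0)"
      by (rule sum.cong[OF refl], rule sum.swap)
    also have "\<dots> = (\<Sum>s<N. \<Sum>m=1..n. unit_act s (w m) (f (w(m := s))))"
      using words_less[OF w] by (intro sum.cong refl) simp
    also have "\<dots> = (\<Sum>l=1..n. mixed_casimir N \<rho> l f w)"
      unfolding mixed_casimir_def by (rule sum.swap)
    finally show ?thesis .
  qed
  have C: "(\<Sum>s<N. \<Sum>t<N. ?C s t) = (\<Sum>l=1..n. mixed_casimir N \<rho> l f w)"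
    by (subst sum.swap) (rule B)
  have inner: "(\<Sum>s<N. \<Sum>t<N. if w l = s then
       (\<Sum>m=1..n. if (w(l := t)) m = t then f (w(l := t, m := s)) else 0) else 0)
     = scale (of_nat N) (f w) + (\<Sum>m\<in>{1..n} - {l}. f (w \<circ> transpose l m))"
    if l: "l \<in> {1..n}" for l
  proof -
    have "(\<Sum>s<N. \<Sum>t<N. if w l = s then
         (\<Sum>m=1..n. if (w(l := t)) m = t then f (w(l := t, m := s)) else 0) else 0)
       = (\<Sum>t<N. \<Sum>m=1..n. if (w(l := t)) m = t then f (w(l := t, m := w l)) else 0)"
      using words_less[OF w l] by (subst sum.swap) simp
    also have "\<dots> = (\<Sum>t<N. f w + (\<Sum>m\<in>{1..n} - {l}. if w m = t then f (w(l := t, m := w l)) else 0))"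
      using l by (intro sum.cong refl) (simp add: sum.remove[of _ l])
    also have "\<dots> = scale (of_nat N) (f w) +
        (\<Sum>m\<in>{1..n} - {l}. \<Sum>t<N. if w m = t then f (w(l := t, m := w l)) else 0)"
      unfolding sum.distrib by (subst sum.swap) (simp add: sum_constant_scale)
    also have "(\<Sum>m\<in>{1..n} - {l}. \<Sum>t<N. if w m = t then f (w(l := t, m := w l)) else 0)
       = (\<Sum>m\<in>{1..n} - {l}. f (w \<circ> transpose l m))"
    proof (intro sum.cong refl)
      fix m assume m: "m \<in> {1..n} - {l}"
      have "w(l := w m, m := w l) = w \<circ> transpose l m"
        by (auto simp: transpose_def fun_eq_iff)
      then show "(\<Sum>t<N. if w m = t then f (w(l := t, m := w l)) else 0) = f (w \<circ> transpose l m)"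
        using words_less[OF w, of m] m by simp
    qed
    finally show ?thesis .
  qed
  have D: "(\<Sum>s<N. \<Sum>t<N. ?D s t) = scale (of_nat (N * n)) (f w)
      + (\<Sum>l=1..n. \<Sum>m\<in>{1..n} - {l}. f (w \<circ> transpose l m))"
  proof -
    have "(\<Sum>s<N. \<Sum>t<N. ?D s t) = (\<Sum>s<N. \<Sum>l=1..n. \<Sum>t<N. if w l = s then
       (\<Sum>m=1..n. if (w(l := t)) m = t then f (w(l := t, m := s)) else 0) else 0)"
      by (rule sum.cong[OF refl], rule sum.swap)
    also have "\<dots> = (\<Sum>l=1..n. \<Sum>s<N. \<Sum>t<N. if w l = s then
       (\<Sum>m=1..n. if (w(l := t)) m = t then f (w(l := t, m := s)) else 0) else 0)"
      by (rule sum.swap)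
    also have "\<dots> = (\<Sum>l=1..n. scale (of_nat N) (f w) + (\<Sum>m\<in>{1..n} - {l}. f (w \<circ> transpose l m)))"
      by (intro sum.cong refl inner)
    also have "\<dots> = scale (of_nat (N * n)) (f w)
      + (\<Sum>l=1..n. \<Sum>m\<in>{1..n} - {l}. f (w \<circ> transpose l m))"
      by (simp add: sum.distrib sum_constant_scale mult.commute)
    finally show ?thesis .
  qed
  have "casimir N (tensor_act scale N n \<rho>) f w
     = (\<Sum>s<N. \<Sum>t<N. unit_act s t (unit_act t s (f w)) + ?B s t + (?C s t + ?D s t))"
    unfolding casimir_def sum_fun_apply by (intro sum.cong refl entry) auto
  also have "\<dots> = casimir N \<rho> (f w) + (\<Sum>s<N. \<Sum>t<N. ?B s t)
      + ((\<Sum>s<N. \<Sum>t<N. ?C s t) + (\<Sum>s<N. \<Sum>t<N. ?D s t))"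
    unfolding casimir_def sum.distrib ..
  also have "\<dots> = casimir N \<rho> (f w) + scale 2 (\<Sum>l=1..n. mixed_casimir N \<rho> l f w)
      + scale (of_nat (N * n)) (f w)
      + (\<Sum>l=1..n. \<Sum>m\<in>{1..n} - {l}. f (w \<circ> transpose l m))"
    unfolding B C D by (simp only: scale_two add.assoc)
  finally show ?thesis .
qed

lemma mixed_casimir_add:
  assumes "f \<in> tensor_space N n M" "g \<in> tensor_space N n M" "w \<in> words N n" "l \<in> {1..n}"
  shows "mixed_casimir N \<rho> l (f + g) w = mixed_casimir N \<rho> l f w + mixed_casimir N \<rho> l g w"
  using assms by (simp add: mixed_casimir_def act_add tensor_space_memD words_update sum.distrib
      del: atLeastAtMost_iff)

lemma mixed_casimir_scale:
  assumes "f \<in> tensor_space N n M" "w \<in> words N n" "l \<in> {1..n}"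
  shows "mixed_casimir N \<rho> l (fscale scale c f) w = scale c (mixed_casimir N \<rho> l f w)"
  using assms by (simp add: mixed_casimir_def act_scale tensor_space_memD words_update
      scale_sum_right fscale_def del: atLeastAtMost_iff)

lemma subspace_tensor_space: "module.subspace (fscale scale) (tensor_space N n M)"
proof -
  interpret fs: vector_space "fscale scale"
    by (rule vector_space_fscale) unfold_locales
  show ?thesis
    by (auto simp: fs.subspace_def tensor_space_def fscale_def
        subspace_add[OF subspace_carrier] subspace_scale[OF subspace_carrier])
qed

lemma casimir_isotypic_component:
  assumes "x \<in> isotypic_component (fscale scale) N (tensor_act scale N n \<rho>) (tensor_space N n M) lam"
  shows "casimir N (tensor_act scale N n \<rho>) x = fscale scale (casimir_value N lam) x"
proof -
  interpret fs: vector_space "fscale scale"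
    by (rule vector_space_fscale) unfold_locales
  let ?C = "casimir N (tensor_act scale N n \<rho>)"
  have outside: "?C f w = 0" if "w \<notin> words N n" for f w
    unfolding casimir_def sum_fun_apply by (simp add: tensor_act_outside that)
  have C_add: "?C (f + g) = ?C f + ?C g"
    if f: "f \<in> tensor_space N n M" and g: "g \<in> tensor_space N n M" for f g
  proof
    fix w
    have fg: "f + g \<in> tensor_space N n M"
      by (rule fs.subspace_add[OF subspace_tensor_space f g])
    have "(\<Sum>l=1..n. mixed_casimir N \<rho> l (f + g) w)
      = (\<Sum>l=1..n. mixed_casimir N \<rho> l f w) + (\<Sum>l=1..n. mixed_casimir N \<rho> l g w)"
      if "w \<in> words N n"
      unfolding sum.distrib[symmetric]
      by (intro sum.cong refl mixed_casimir_add[OF f g that])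
    then show "?C (f + g) w = (?C f + ?C g) w"
      by (cases "w \<in> words N n")
        (simp_all add: outside casimir_tensor_act[OF fg] casimir_tensor_act[OF f]
          casimir_tensor_act[OF g] casimir_add tensor_space_memD[OF f] tensor_space_memD[OF g]
          scale_right_distrib sum.distrib)
  qed
  have C_scale: "?C (fscale scale c f) = fscale scale c (?C f)"
    if f: "f \<in> tensor_space N n M" for c f
  proof
    fix w
    have cf: "fscale scale c f \<in> tensor_space N n M"
      by (rule fs.subspace_scale[OF subspace_tensor_space f])
    have "(\<Sum>l=1..n. mixed_casimir N \<rho> l (fscale scale c f) w)
      = scale c (\<Sum>l=1..n. mixed_casimir N \<rho> l f w)" if "w \<in> words N n"
      unfolding scale_sum_right by (intro sum.cong refl mixed_casimir_scale[OF f that])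
    then show "?C (fscale scale c f) w = fscale scale c (?C f) w"
      by (cases "w \<in> words N n")
        (simp_all add: outside casimir_tensor_act[OF cf] casimir_tensor_act[OF f]
          casimir_scale tensor_space_memD[OF f] scale_right_distrib scale_sum_right
          fscale_apply mult.commute)
  qed
  let ?E = "{f \<in> tensor_space N n M. ?C f = fscale scale (casimir_value N lam) f}"
  have "?C 0 = 0"
    using C_scale[of 0 0] fs.subspace_0[OF subspace_tensor_space] by simp
  then have "fs.subspace ?E"
    using subspace_tensor_space
    by (auto simp: fs.subspace_def C_add C_scale fs.scale_right_distrib mult.commute
        simp del: plus_fun_apply)
  moreover have "\<Union>{S. S \<subseteq> tensor_space N n M \<and>
      highest_weight_irrep (fscale scale) N (tensor_act scale N n \<rho>) S lam} \<subseteq> ?E"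
    using casimir_highest_weight_irrep by blast
  ultimately have "isotypic_component (fscale scale) N (tensor_act scale N n \<rho>) (tensor_space N n M) lam \<subseteq> ?E"
    unfolding isotypic_component_def by (intro fs.span_minimal)
  with assms show ?thesis by blast
qed

text \<open>
  The Casimir operator of \<open>M \<otimes> V\<^sup>\<otimes>\<^sup>k\<close> acting on the factors \<open>0, \<dots>, k\<close> of \<open>M \<otimes> V\<^sup>\<otimes>\<^sup>n\<close> for
  \<open>k \<le> n\<close>, written in the expanded form of \<open>casimir_tensor_act\<close>. This form makes sense
  directly on words of length \<open>n\<close>.
\<close>

definition partial_casimir :: "nat \<Rightarrow> ((nat \<Rightarrow> nat) \<Rightarrow> 'v) \<Rightarrow> (nat \<Rightarrow> nat) \<Rightarrow> 'v" where
  "partial_casimir k f w = casimir N \<rho> (f w) + scale 2 (\<Sum>l=1..k. mixed_casimir N \<rho> l f w)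
      + scale (of_nat (N * k)) (f w)
      + (\<Sum>l=1..k. \<Sum>m\<in>{1..k} - {l}. f (w \<circ> transpose l m))"

lemma partial_casimir_Suc:
  "partial_casimir (Suc k) f w = partial_casimir k f w + scale 2 (mixed_casimir N \<rho> (Suc k) f w
      + (\<Sum>l=1..k. f (w \<circ> transpose l (Suc k)))) + scale (of_nat N) (f w)"
proof -
  have "(\<Sum>m\<in>{1..Suc k} - {l}. f (w \<circ> transpose l m))
      = (\<Sum>m\<in>{1..k} - {l}. f (w \<circ> transpose l m)) + f (w \<circ> transpose l (Suc k))"
    if "l \<in> {1..k}" for l
  proof -
    have "{1..Suc k} - {l} = insert (Suc k) ({1..k} - {l})" using that by auto
    then show ?thesis by (simp add: add.commute)
  qed
  moreover have "{1..Suc k} - {Suc k} = {1..k}" by auto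
  ultimately have "(\<Sum>l=1..Suc k. \<Sum>m\<in>{1..Suc k} - {l}. f (w \<circ> transpose l m))
    = (\<Sum>l=1..k. \<Sum>m\<in>{1..k} - {l}. f (w \<circ> transpose l m))
      + scale 2 (\<Sum>l=1..k. f (w \<circ> transpose l (Suc k)))"
    by (simp add: sum.distrib transpose_commute scale_two)
  then show ?thesis
    unfolding partial_casimir_def
    by (simp add: scale_right_distrib scale_left_distrib algebra_simps)
qed

text \<open>
  The Casimir operator on the factors \<open>0, \<dots>, k\<close> is evaluated at \<open>w\<close> by fixing the letters of \<open>w\<close>
  after the \<open>k\<close>-th.
\<close>

lemma partial_casimir_extend_subspace:
  assumes k: "k \<le> n" and w: "w \<in> words N n"
    and f: "f \<in> extend_subspace N k n M
      (isotypic_component (fscale scale) N (tensor_act scale N k \<rho>) (tensor_space N k M) lam)"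
  shows "partial_casimir k f w = scale (casimir_value N lam) (f w)"
proof -
  define u where "u = restrict w {k + 1..n}"
  define x where "x = restrict w {1..k}"
  let ?g = "left_coefficient N k f u"
  have u: "u \<in> {k + 1..n} \<rightarrow>\<^sub>E {..<N}" and x: "x \<in> words N k"
    using w k by (auto simp: u_def x_def words_def)
  have g: "?g y = f (override_on u y {1..k})" if "y \<in> words N k" for y
    using that by (simp add: left_coefficient_def)
  have split: "override_on u y {1..k} = z"
    if "\<And>i. i \<in> {1..k} \<Longrightarrow> y i = z i" "\<And>i. i \<notin> {1..k} \<Longrightarrow> z i = w i" for y z
  proof
    fix i
    have "w i = undefined" if "i \<notin> {1..n}" using w that by (auto simp: words_def PiE_iff extensional_def)
    then show "override_on u y {1..k} i = z i"
      using that by (cases "i \<in> {1..k}"; cases "i \<in> {k + 1..n}") (auto simp: u_def)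
  qed
  have gx: "?g x = f w"
    unfolding g[OF x] by (rule arg_cong[of _ _ f], rule split) (auto simp: x_def)
  have g_upd: "?g (x(l := s)) = f (w(l := s))" if "l \<in> {1..k}" "s < N" for l s
    unfolding g[OF words_update[OF x that]]
    by (rule arg_cong[of _ _ f], rule split) (use that in \<open>auto simp: x_def\<close>)
  have g_swap: "?g (x \<circ> transpose l m) = f (w \<circ> transpose l m)"
    if lm: "l \<in> {1..k}" "m \<in> {1..k}" for l m
  proof -
    have "x \<circ> transpose l m \<in> words N k" using x words_transpose[OF lm] by blast
    then show ?thesis
      unfolding g[OF \<open>x \<circ> transpose l m \<in> words N k\<close>]
      by (intro arg_cong[of _ _ f] split) (use lm in \<open>auto simp: x_def transpose_def\<close>)
  qed
  have fT: "f \<in> tensor_space N n M" using f by (simp add: extend_subspace_def)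
  have "override_on u y {1..k} \<in> words N n" if "y \<in> words N k" for y
    using that u k by (auto simp: words_def PiE_iff extensional_def override_on_def)
  then have gT: "?g \<in> tensor_space N k M"
    using fT by (auto simp: tensor_space_def left_coefficient_def)
  have "?g \<in> isotypic_component (fscale scale) N (tensor_act scale N k \<rho>) (tensor_space N k M) lam"
    using f u by (simp add: extend_subspace_def)
  from fun_cong[OF casimir_isotypic_component[OF this], of x]
  have *: "casimir N (tensor_act scale N k \<rho>) ?g x = scale (casimir_value N lam) (f w)"
    by (simp add: fscale_def gx)
  have mixed: "mixed_casimir N \<rho> l ?g x = mixed_casimir N \<rho> l f w" if "l \<in> {1..k}" for l
    unfolding mixed_casimir_def
    using that by (intro sum.cong refl) (simp add: g_upd, simp add: x_def)
  have "casimir N (tensor_act scale N k \<rho>) ?g x = partial_casimir k f w"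
    unfolding casimir_tensor_act[OF gT x] partial_casimir_def gx
    by (intro arg_cong2[of _ _ _ _ "(+)"] arg_cong[of _ _ "scale 2"] sum.cong refl mixed g_swap) auto
  with * show ?thesis by simp
qed

end

section \<open>Block diagonal weights\<close>

lemma swap_tensor_act:
  assumes kl: "k \<in> {1..n}" "l \<in> {1..n}"
  shows "tensor_act scale N n \<rho> A (swap_factors k l f) = swap_factors k l (tensor_act scale N n \<rho> A f)"
proof
  fix w
  let ?\<tau> = "transpose k l"
  have w: "w \<circ> ?\<tau> \<in> words N n \<longleftrightarrow> w \<in> words N n" by (rule words_transpose[OF kl])
  have upd: "w(m := j) \<circ> ?\<tau> = (w \<circ> ?\<tau>)(?\<tau> m := j)" for m j
    by (auto simp: fun_eq_iff transpose_def)
  have bij: "bij_betw ?\<tau> {1..n} {1..n}"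
    using kl by (intro bij_betw_byWitness[of _ ?\<tau>]) (auto simp: transpose_def)
  have "(\<Sum>m=1..n. \<Sum>j<N. scale (A $$ (w m, j)) (f ((w \<circ> ?\<tau>)(?\<tau> m := j))))
      = (\<Sum>m=1..n. \<Sum>j<N. scale (A $$ ((w \<circ> ?\<tau>) m, j)) (f ((w \<circ> ?\<tau>)(m := j))))"
    using sum.reindex_bij_betw[OF bij, of "\<lambda>m. \<Sum>j<N. scale (A $$ ((w \<circ> ?\<tau>) m, j)) (f ((w \<circ> ?\<tau>)(m := j)))"]
    by simp
  then show "tensor_act scale N n \<rho> A (swap_factors k l f) w = swap_factors k l (tensor_act scale N n \<rho> A f) w"
    unfolding tensor_act_def act_factor0_def act_factor_def swap_factors_def plus_fun_apply sum_fun_apply upd w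
    by (cases "w \<in> words N n") auto
qed

lemma block_diag_carrier:
  "S \<in> carrier_mat p p \<Longrightarrow> T \<in> carrier_mat q q \<Longrightarrow> block_diag S T \<in> carrier_mat (p + q) (p + q)"
  by (auto simp: block_diag_def)

lemma block_diag_index:
  assumes "S \<in> carrier_mat p p" "T \<in> carrier_mat q q" "i < p + q" "j < p + q"
  shows "block_diag S T $$ (i, j) = (if i < p \<and> j < p then S $$ (i, j)
     else if p \<le> i \<and> p \<le> j then T $$ (i - p, j - p) else 0)"
  using assms by (auto simp: block_diag_def)

lemma gamma_op_apply:
  assumes sc: "vector_space scale" and w: "w \<in> words (p + q) n" and k: "k \<in> {1..n}"
  shows "gamma_op scale p q n k f w = scale (if w k < p then 1 else - 1) (f w)"
proof -
  interpret vector_space scale by fact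
  have "J_mat p q $$ (w k, j) = (if j = w k then (if w k < p then 1 else - 1) else 0)" if "j < p + q" for j
    using that words_less[OF w k] by (auto simp: J_mat_def block_diag_index[of "1\<^sub>m p" p "- 1\<^sub>m q" q])
  then have entry: "scale (J_mat p q $$ (w k, j)) (f (w(k := j)))
      = (if j = w k then scale (if w k < p then 1 else - 1) (f w) else 0)" if "j < p + q" for j
    using that by auto
  have "gamma_op scale p q n k f w
      = (\<Sum>j<p + q. if j = w k then scale (if w k < p then 1 else - 1) (f w) else 0)"
    unfolding gamma_op_def act_factor_def if_P[OF w] by (intro sum.cong refl entry) simp
  then show ?thesis using words_less[OF w k] by simp
qed

text \<open>
  A tensor on which \<open>E\<^sub>s\<^sup>t\<close> acts by \<open>0\<close> for different \<open>s, t\<close> in the same block, and \<open>E\<^sub>s\<^sup>s\<close> by \<open>c s\<close>.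
  The blocks are \<open>{..<p}\<close> and \<open>{p..<N}\<close>.
\<close>

definition block_weight_vector ::
    "(complex \<Rightarrow> 'm::ab_group_add \<Rightarrow> 'm) \<Rightarrow> nat \<Rightarrow> nat \<Rightarrow> (complex mat \<Rightarrow> 'm \<Rightarrow> 'm) \<Rightarrow> 'm set \<Rightarrow> nat \<Rightarrow> (nat \<Rightarrow> complex) \<Rightarrow> ((nat \<Rightarrow> nat) \<Rightarrow> 'm) \<Rightarrow> bool" where
  "block_weight_vector scale N n \<rho> M p c v \<longleftrightarrow> v \<in> tensor_space N n M \<and>
     (\<forall>s<N. \<forall>t<N. (s < p \<longleftrightarrow> t < p) \<longrightarrow>
        tensor_act scale N n \<rho> (matrix_unit N s t) v = fscale scale (if s = t then c s else 0) v)"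

lemma block_weight_vector_swap:
  assumes "k \<in> {1..n}" "l \<in> {1..n}" "block_weight_vector scale N n \<rho> M p c v"
  shows "block_weight_vector scale N n \<rho> M p c (swap_factors k l v)"
  using assms by (simp add: block_weight_vector_def swap_tensor_space swap_tensor_act)
    (auto simp: swap_factors_def fscale_def)

text \<open>
  The condition on traceless block diagonal matrices is applied to \<open>E\<^sub>s\<^sup>t\<close> minus a multiple of the
  identity matrix, and the identity matrix acts by the scalar \<open>d + n\<close> on the tensor product.
\<close>

lemma F_space_block_weight_vector:
  assumes mod: "gl_module scale N \<rho> M" and N: "N = p + q" "N > 0"
    and one: "\<And>x. x \<in> M \<Longrightarrow> \<rho> (1\<^sub>m N) x = scale d x"
    and v: "v \<in> F_space scale p q n \<mu> \<rho> M"
  shows "block_weight_vector scale N n \<rho> M p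
    (\<lambda>s. (if s < p then \<mu> * of_nat q else - \<mu> * of_nat p) + (d + of_nat n) / of_nat N) v"
proof -
  interpret gl_module scale N \<rho> M by fact
  have vT: "v \<in> tensor_space N n M" using v N by (simp add: F_space_def)
  let ?c = "\<lambda>s. (if s < p then \<mu> * of_nat q else - \<mu> * of_nat p) + (d + of_nat n) / of_nat N"
  have "tensor_act scale N n \<rho> (matrix_unit N s t) v w = scale (if s = t then ?c s else 0) (v w)"
    if st: "s < N" "t < N" "s < p \<longleftrightarrow> t < p" for s t w
  proof (cases "w \<in> words N n")
    case w: True
    \<comment> \<open>The matrix \<open>E\<^sub>s\<^sup>t - e I\<close> is traceless, and it is block diagonal with blocks \<open>S\<close> and \<open>T\<close>.\<close>
    define e :: complex where "e = (if s = t then 1 / of_nat N else 0)"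
    define S where "S = mat p p (\<lambda>(i, j). (if i = s \<and> j = t then 1 else 0) - (if i = j then e else 0))"
    define T where "T = mat q q (\<lambda>(i, j). (if i + p = s \<and> j + p = t then 1 else 0) - (if i = j then e else 0))"
    have ST: "S \<in> carrier_mat p p" "T \<in> carrier_mat q q" by (simp_all add: S_def T_def)
    have block: "block_diag S T = matrix_unit N s t + (- e) \<cdot>\<^sub>m 1\<^sub>m N"
    proof (rule eq_matI)
      fix i j assume "i < dim_row (matrix_unit N s t + (- e) \<cdot>\<^sub>m 1\<^sub>m N)"
        "j < dim_col (matrix_unit N s t + (- e) \<cdot>\<^sub>m 1\<^sub>m N)"
      then have ij: "i < N" "j < N" by simp_all
      have off: "\<not> (i = s \<and> j = t) \<and> i \<noteq> j" if "\<not> (i < p \<longleftrightarrow> j < p)" using that st(3) by auto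
      have "block_diag S T $$ (i, j) = (if i = s \<and> j = t then 1 else 0) - (if i = j then e else 0)"
        unfolding block_diag_index[OF ST ij[unfolded N(1)]]
        using ij N(1) off by (cases "i < p"; cases "j < p") (simp_all add: S_def T_def eq_diff_iff)
      then show "block_diag S T $$ (i, j) = (matrix_unit N s t + (- e) \<cdot>\<^sub>m 1\<^sub>m N) $$ (i, j)"
        using ij by simp
    qed (use block_diag_carrier[OF ST] N(1) in auto)
    have trS: "mat_trace S = (if s = t \<and> s < p then 1 else 0) - of_nat p * e"
    proof -
      have "mat_trace S = (\<Sum>i<p. (if i = s then (if s = t then 1 else 0) else 0) - e)"
        unfolding mat_trace_def by (rule sum.cong) (auto simp: S_def)
      then show ?thesis by (simp add: sum_subtractf)
    qed
    have trT: "mat_trace T = (if s = t \<and> p \<le> s then 1 else 0) - of_nat q * e"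
    proof -
      have "mat_trace T = (\<Sum>i<q. (if i = s - p then (if s = t \<and> p \<le> s then 1 else 0) else 0) - e)"
        unfolding mat_trace_def by (rule sum.cong) (auto simp: T_def)
      then show ?thesis using st N by (auto simp: sum_subtractf)
    qed
    have "mat_trace (block_diag S T) = (\<Sum>i<N. (if i = s then (if s = t then 1 else 0) else 0) - e)"
      unfolding block mat_trace_def by (rule sum.cong) auto
    also have "\<dots> = 0" using st(1) N(2) by (simp add: sum_subtractf e_def)
    finally have "tensor_act scale N n \<rho> (block_diag S T) v
        = fscale scale (\<mu> * (of_nat q * mat_trace S - of_nat p * mat_trace T)) v"
      using v ST N by (simp add: F_space_def)
    moreover have "of_nat q * mat_trace S - of_nat p * mat_trace T
       = (if s = t then (if s < p then of_nat q else - of_nat p) else 0)"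
      by (simp add: trS trT algebra_simps)
    ultimately have 1: "tensor_act scale N n \<rho> (block_diag S T) v w
       = scale (\<mu> * (if s = t then (if s < p then of_nat q else - of_nat p) else 0)) (v w)"
      by (simp add: fscale_def)
    have vw: "v w \<in> M" by (rule tensor_space_memD[OF vT w])
    have "tensor_act scale N n \<rho> (block_diag S T) v w
       = \<rho> (matrix_unit N s t) (v w) + scale (- e * d) (v w)
         + (\<Sum>l=1..n. \<Sum>j<N. scale ((matrix_unit N s t + (- e) \<cdot>\<^sub>m 1\<^sub>m N) $$ (w l, j)) (v (w(l := j))))"
      using w vw unfolding block
      by (subst tensor_act_apply) (simp_all add: add_act smult_act one del: scale_minus_left)
    also have "(\<Sum>l=1..n. \<Sum>j<N. scale ((matrix_unit N s t + (- e) \<cdot>\<^sub>m 1\<^sub>m N) $$ (w l, j)) (v (w(l := j))))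
       = (\<Sum>l=1..n. (\<Sum>j<N. scale (matrix_unit N s t $$ (w l, j)) (v (w(l := j)))) + scale (- e) (v w))"
    proof (rule sum.cong[OF refl])
      fix l assume l: "l \<in> {1..n}"
      have wl: "w l < N" by (rule words_less[OF w l])
      have "scale ((matrix_unit N s t + (- e) \<cdot>\<^sub>m 1\<^sub>m N) $$ (w l, j)) (v (w(l := j)))
         = scale (matrix_unit N s t $$ (w l, j)) (v (w(l := j))) + (if j = w l then scale (- e) (v w) else 0)"
        if "j < N" for j
        using that wl by (auto simp: scale_left_distrib scale_left_diff_distrib)
      then show "(\<Sum>j<N. scale ((matrix_unit N s t + (- e) \<cdot>\<^sub>m 1\<^sub>m N) $$ (w l, j)) (v (w(l := j))))
        = (\<Sum>j<N. scale (matrix_unit N s t $$ (w l, j)) (v (w(l := j)))) + scale (- e) (v w)"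
        using wl by (simp add: sum.distrib del: scale_minus_left)
    qed
    also have "\<dots> = (\<Sum>l=1..n. \<Sum>j<N. scale (matrix_unit N s t $$ (w l, j)) (v (w(l := j))))
        + scale (- e * of_nat n) (v w)"
      by (simp add: sum.distrib sum_constant_scale mult.commute del: scale_minus_left)
    finally have 2: "tensor_act scale N n \<rho> (block_diag S T) v w
      = tensor_act scale N n \<rho> (matrix_unit N s t) v w + scale (- e * (d + of_nat n)) (v w)"
      unfolding tensor_act_apply[OF w]
      by (simp only: distrib_left scale_left_distrib add_ac)
    have "tensor_act scale N n \<rho> (matrix_unit N s t) v w
      = scale (\<mu> * (if s = t then (if s < p then of_nat q else - of_nat p) else 0) + e * (d + of_nat n)) (v w)"
      using 1 2 by (simp add: scale_left_distrib algebra_simps)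
    also have "\<mu> * (if s = t then (if s < p then of_nat q else - of_nat p) else 0) + e * (d + of_nat n)
      = (if s = t then ?c s else 0)"
      by (simp add: e_def)
    finally show ?thesis .
  next
    case False
    then show ?thesis using vT by (simp add: tensor_act_outside tensor_space_outside)
  qed
  with vT show ?thesis by (auto simp: block_weight_vector_def fscale_def fun_eq_iff)
qed

text \<open>
  The part of \<open>\<Omega>\<^sub>k v\<close> given by the pairs of indices in the same block. For a letter \<open>s\<close> in the block
  of \<open>w k\<close>, the block weight condition for \<open>E\<^sub>s\<^sup>t\<close> with \<open>t = w k\<close> is evaluated at the word \<open>w(k := s)\<close>.
  It contains the term of \<open>\<Omega>\<^sub>k\<close> with this \<open>s\<close>, the term \<open>v w\<close> from the \<open>k\<close>-th factor, and
  exchanges with the other factors.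
\<close>

lemma block_weight_vector_mixed_casimir:
  assumes mod: "gl_module scale N \<rho> M" and v: "block_weight_vector scale N n \<rho> M p c v"
    and w: "w \<in> words N n" and k: "k \<in> {1..n}"
  shows "(\<Sum>s\<in>{s. s < N \<and> (s < p \<longleftrightarrow> w k < p)}. \<rho> (matrix_unit N s (w k)) (v (w(k := s))))
    = scale (c (w k) - of_nat (card {s. s < N \<and> (s < p \<longleftrightarrow> w k < p)})) (v w)
      - (\<Sum>l\<in>{1..n} - {k}. if w l < p \<longleftrightarrow> w k < p then v (w \<circ> transpose k l) else 0)"
    (is "_ = scale (_ - of_nat (card ?B)) _ - _")
proof -
  interpret gl_module scale N \<rho> M by fact
  have wk: "w k < N" by (rule words_less[OF w k])
  have unit_term: "unit_act s (w k) (v (w(k := s))) + v w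
      + (\<Sum>l\<in>{1..n} - {k}. if w l = s then v (w \<circ> transpose k l) else 0)
      = (if s = w k then scale (c (w k)) (v w) else 0)" if s: "s \<in> ?B" for s
  proof -
    have ws: "w(k := s) \<in> words N n" using words_update[OF w k] s by simp
    have "(\<Sum>l=1..n. if (w(k := s)) l = s then v (w(k := s, l := w k)) else 0)
      = v w + (\<Sum>l\<in>{1..n} - {k}. if (w(k := s)) l = s then v (w(k := s, l := w k)) else 0)"
      using k by (subst sum.remove[of _ k]) auto
    also have "(\<Sum>l\<in>{1..n} - {k}. if (w(k := s)) l = s then v (w(k := s, l := w k)) else 0)
      = (\<Sum>l\<in>{1..n} - {k}. if w l = s then v (w \<circ> transpose k l) else 0)"
    proof (rule sum.cong[OF refl])
      fix l assume "l \<in> {1..n} - {k}"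
      then have "(w(k := s)) l = w l" by simp
      moreover have "w(k := w l, l := w k) = w \<circ> transpose k l"
        by (auto simp: fun_eq_iff transpose_def)
      ultimately show "(if (w(k := s)) l = s then v (w(k := s, l := w k)) else 0)
        = (if w l = s then v (w \<circ> transpose k l) else 0)" by auto
    qed
    finally have "tensor_act scale N n \<rho> (matrix_unit N s (w k)) v (w(k := s))
      = unit_act s (w k) (v (w(k := s))) + (v w
      + (\<Sum>l\<in>{1..n} - {k}. if w l = s then v (w \<circ> transpose k l) else 0))"
      using tensor_act_unit[OF ws wk] by simp
    moreover have "tensor_act scale N n \<rho> (matrix_unit N s (w k)) v
        = fscale scale (if s = w k then c s else 0) v"
      using v s wk unfolding block_weight_vector_def by blast
    ultimately show ?thesis by (auto simp: fscale_def add.assoc)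
  qed
  have fin: "finite ?B" by simp
  have "(\<Sum>s\<in>?B. unit_act s (w k) (v (w(k := s))) + v w
      + (\<Sum>l\<in>{1..n} - {k}. if w l = s then v (w \<circ> transpose k l) else 0))
      = (\<Sum>s\<in>?B. if s = w k then scale (c (w k)) (v w) else 0)"
    by (intro sum.cong refl unit_term)
  also have "\<dots> = scale (c (w k)) (v w)" using wk by simp
  finally have eq: "(\<Sum>s\<in>?B. unit_act s (w k) (v (w(k := s)))) + scale (of_nat (card ?B)) (v w)
     + (\<Sum>s\<in>?B. \<Sum>l\<in>{1..n} - {k}. if w l = s then v (w \<circ> transpose k l) else 0)
     = scale (c (w k)) (v w)"
    by (simp only: sum.distrib sum_constant_scale)
  have "(\<Sum>s\<in>?B. \<Sum>l\<in>{1..n} - {k}. if w l = s then v (w \<circ> transpose k l) else 0)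
     = (\<Sum>l\<in>{1..n} - {k}. \<Sum>s\<in>?B. if w l = s then v (w \<circ> transpose k l) else 0)"
    by (rule sum.swap)
  also have "\<dots> = (\<Sum>l\<in>{1..n} - {k}. if w l < p \<longleftrightarrow> w k < p then v (w \<circ> transpose k l) else 0)"
    using words_less[OF w] by (intro sum.cong refl) (simp add: fin)
  finally show ?thesis using eq
    by (simp add: scale_left_diff_distrib algebra_simps)
qed

section \<open>The operators as Jucys--Murphy operators\<close>

lemma y1_op_block_weight_vector:
  assumes mod: "gl_module scale N \<rho> M" and N: "N = p + q" and n: "n \<ge> 1"
    and v: "block_weight_vector scale N n \<rho> M p
       (\<lambda>s. (if s < p then \<mu> * of_nat q else - \<mu> * of_nat p) + K) v"
    and w: "w \<in> words N n"
  shows "y1_op scale p q n \<mu> \<rho> v w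
    = scale (K + (\<mu> * of_nat q - \<mu> * of_nat p) / 2 - of_nat N / 2) (v w) - mixed_casimir N \<rho> 1 v w"
proof -
  interpret gl_module scale N \<rho> M by fact
  have k: "1 \<in> {1..n}" using n by simp
  have w1: "w 1 < N" by (rule words_less[OF w k])
  have vT: "v \<in> tensor_space N n M" using v by (simp add: block_weight_vector_def)
  let ?f = "\<lambda>s. unit_act s (w 1) (v (w(1 := s)))"
  let ?B = "{s. s < N \<and> (s < p \<longleftrightarrow> w 1 < p)}"
  let ?\<epsilon> = "\<lambda>i. if i < p then 1 else - 1 :: complex"
  have EE: "EE_op scale N n \<rho> s t v w = (if t = w 1 then ?f s else 0)" if "s < N" "t < N" for s t
    using that w w1 by (simp add: EE_op_def act_factor0_def act_factor_def unit_sum del: matrix_unit_index)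
  \<comment> \<open>The sum over \<open>s|t\<close> is the part of \<open>\<Omega>\<^sub>1\<close> with \<open>s\<close> and \<open>t\<close> in different blocks.\<close>
  have E1: "(\<Sum>s<p. \<Sum>t=p..<p + q. EE_op scale N n \<rho> s t v w) = (if w 1 < p then 0 else sum ?f {..<p})"
  proof -
    have "(\<Sum>s<p. \<Sum>t=p..<p + q. EE_op scale N n \<rho> s t v w)
      = (\<Sum>s<p. \<Sum>t=p..<p + q. if t = w 1 then ?f s else 0)"
      by (intro sum.cong refl EE) (auto simp: N)
    then show ?thesis using w1 N by auto
  qed
  have E2: "(\<Sum>t<p. \<Sum>s=p..<p + q. EE_op scale N n \<rho> s t v w) = (if w 1 < p then sum ?f {p..<p + q} else 0)"
  proof -
    have "(\<Sum>t<p. \<Sum>s=p..<p + q. EE_op scale N n \<rho> s t v w)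
      = (\<Sum>t<p. \<Sum>s=p..<p + q. if t = w 1 then ?f s else 0)"
      by (intro sum.cong refl EE) (auto simp: N)
    then show ?thesis by (subst (asm) sum.swap) simp
  qed
  have sets: "{..<N} - ?B = (if w 1 < p then {p..<p + q} else {..<p})" "?B \<subseteq> {..<N}"
    using N by auto
  have off: "(\<Sum>s<p. \<Sum>t=p..<p + q. EE_op scale N n \<rho> s t v w)
      + (\<Sum>t<p. \<Sum>s=p..<p + q. EE_op scale N n \<rho> s t v w) = mixed_casimir N \<rho> 1 v w - sum ?f ?B"
    unfolding E1 E2 mixed_casimir_def sum_diff[OF finite_lessThan sets(2), symmetric] sets(1) by simp
  have swap: "swap_factors 1 l (gamma_op scale p q n 1 (gamma_op scale p q n l v)) w
     = scale (?\<epsilon> (w l) * ?\<epsilon> (w 1)) (v (w \<circ> transpose 1 l))" if l: "l \<in> {2..n}" for l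
  proof -
    have l': "l \<in> {1..n}" using l by auto
    have w': "w \<circ> transpose 1 l \<in> words (p + q) n" using words_transpose[OF k l'] w N by blast
    show ?thesis
      unfolding swap_factors_def gamma_op_apply[OF vector_space_axioms w' k]
        gamma_op_apply[OF vector_space_axioms w' l'] by simp
  qed
  \<comment> \<open>\<open>(1 + \<gamma>\<^sub>1 \<gamma>\<^sub>l) / 2\<close> projects to the words whose letters \<open>1\<close> and \<open>l\<close> are in the same block.\<close>
  have half: "scale (1 / 2) (\<Sum>l=2..n. v (w \<circ> transpose 1 l))
      + scale (1 / 2) (\<Sum>l=2..n. scale (?\<epsilon> (w l) * ?\<epsilon> (w 1)) (v (w \<circ> transpose 1 l)))
     = (\<Sum>l=2..n. if w l < p \<longleftrightarrow> w 1 < p then v (w \<circ> transpose 1 l) else 0)"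
    unfolding scale_sum_right sum.distrib[symmetric]
    by (intro sum.cong refl) (auto simp flip: scale_left_distrib)
  have set: "{1..n} - {1} = {2..n}" by auto
  note same = block_weight_vector_mixed_casimir[OF mod v w k, unfolded set]
  have card: "of_nat (card ?B) = (if w 1 < p then of_nat p else of_nat q :: complex)"
  proof -
    have B: "?B = (if w 1 < p then {..<p} else {p..<p + q})" using N by auto
    show ?thesis unfolding B by simp
  qed
  have w': "w \<in> words (p + q) n" using w N by simp
  have "y1_op scale p q n \<mu> \<rho> v w = - (mixed_casimir N \<rho> 1 v w - sum ?f ?B)
     + scale ((of_nat p - of_nat q - \<mu> * of_nat (p + q)) / 2) (scale (?\<epsilon> (w 1)) (v w))
     + (scale (1 / 2) (\<Sum>l=2..n. v (w \<circ> transpose 1 l))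
      + scale (1 / 2) (\<Sum>l=2..n. scale (?\<epsilon> (w l) * ?\<epsilon> (w 1)) (v (w \<circ> transpose 1 l))))"
  proof -
    have "(\<Sum>l=2..n. swap_factors 1 l (gamma_op scale p q n 1 (gamma_op scale p q n l v)) w)
      = (\<Sum>l=2..n. scale (?\<epsilon> (w l) * ?\<epsilon> (w 1)) (v (w \<circ> transpose 1 l)))"
      by (intro sum.cong refl swap)
    then show ?thesis
      unfolding N y1_op_def plus_fun_apply uminus_apply sum_fun_apply fscale_apply off[unfolded N]
        gamma_op_apply[OF vector_space_axioms w' k]
      by (simp only: swap_factors_def add.assoc)
  qed
  also have "\<dots> = - mixed_casimir N \<rho> 1 v w
      + scale (((if w 1 < p then \<mu> * of_nat q else - \<mu> * of_nat p) + K - of_nat (card ?B))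
        + (of_nat p - of_nat q - \<mu> * of_nat (p + q)) / 2 * ?\<epsilon> (w 1)) (v w)"
    unfolding half same by (simp only: scale_left_distrib scale_scale) simp
  also have "((if w 1 < p then \<mu> * of_nat q else - \<mu> * of_nat p) + K - of_nat (card ?B))
        + (of_nat p - of_nat q - \<mu> * of_nat (p + q)) / 2 * ?\<epsilon> (w 1)
     = K + (\<mu> * of_nat q - \<mu> * of_nat p) / 2 - of_nat N / 2"
    unfolding card unfolding N by (auto simp: field_simps)
  finally show ?thesis by simp
qed

lemma y_op_outside:
  assumes "vector_space scale" "1 \<le> k" "k \<le> n" "f \<in> tensor_space (p + q) n M" "w \<notin> words (p + q) n"
  shows "y_op scale p q n \<mu> \<rho> k f w = 0"
  using assms(2-5)
proof (induction k arbitrary: f w rule: nat_induct_at_least)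
  case base
  interpret vector_space scale by fact
  have k: "1 \<in> {1..n}" using base by simp
  have swap: "(\<Sum>l=2..n. swap_factors 1 l (g l) w) = 0"
    if "\<And>l w'. w' \<notin> words (p + q) n \<Longrightarrow> g l w' = 0" for g :: "nat \<Rightarrow> _ \<Rightarrow> 'a"
  proof (intro sum.neutral ballI)
    fix l assume "l \<in> {2..n}"
    then have "w \<circ> transpose 1 l \<notin> words (p + q) n"
      using base(3) words_transpose[OF k, of l w "p + q"] by auto
    then show "swap_factors 1 l (g l) w = 0" by (simp add: swap_factors_def that)
  qed
  have EE: "EE_op scale (p + q) n \<rho> s t f w = 0" for s t
    using base(3) by (simp add: EE_op_def act_factor0_def)
  have gamma: "gamma_op scale p q n l g w' = 0" if "w' \<notin> words (p + q) n" for l g w'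
    using that by (simp add: gamma_op_def act_factor_def)
  have "(\<Sum>l=2..n. swap_factors 1 l f w) = 0"
    using tensor_space_outside[OF base(2)] by (rule swap)
  moreover have "(\<Sum>l=2..n. swap_factors 1 l (gamma_op scale p q n 1 (gamma_op scale p q n l f)) w) = 0"
    by (intro swap gamma)
  ultimately have "y1_op scale p q n \<mu> \<rho> f w = 0"
    by (simp add: y1_op_def sum_fun_apply fscale_apply EE gamma[OF base(3)])
  then show ?case by simp
next
  case (Suc k)
  have k: "k \<in> {1..n}" "Suc k \<in> {1..n}" using Suc by auto
  then obtain j where j: "k = Suc j" using not0_implies_Suc by fastforce
  have w: "w \<circ> transpose k (Suc k) \<notin> words (p + q) n" using words_transpose[OF k] Suc by blast
  have "y_op scale p q n \<mu> \<rho> k (swap_factors k (Suc k) f) (w \<circ> transpose k (Suc k)) = 0"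
    using k Suc by (intro Suc.IH w swap_tensor_space) auto
  then show ?case
    using tensor_space_outside[OF Suc.prems(2) w] by (simp add: j swap_factors_def comp_def)
qed

text \<open>
  Conjugation by \<open>s\<^sub>k\<close> turns \<open>\<Omega>\<^sub>k\<close> and \<open>s\<^bsub>l,k\<^esub>\<close>, for \<open>l < k\<close>, into \<open>\<Omega>\<^bsub>k+1\<^esub>\<close> and \<open>s\<^bsub>l,k+1\<^esub>\<close>. The
  subtraction of \<open>s\<^sub>k\<close> in the recursion supplies the missing exchange \<open>s\<^bsub>k,k+1\<^esub>\<close>.
\<close>

lemma y_op_block_weight_vector:
  assumes mod: "gl_module scale N \<rho> M" and N: "N = p + q"
    and "1 \<le> k" "k \<le> n"
    and "block_weight_vector scale N n \<rho> M p
       (\<lambda>s. (if s < p then \<mu> * of_nat q else - \<mu> * of_nat p) + K) v"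
    and "w \<in> words N n"
  shows "y_op scale p q n \<mu> \<rho> k v w
    = scale (K + (\<mu> * of_nat q - \<mu> * of_nat p) / 2 - of_nat N / 2) (v w)
      - (mixed_casimir N \<rho> k v w + (\<Sum>l=1..<k. v (w \<circ> transpose l k)))"
  using assms(3-6)
proof (induction k arbitrary: v w rule: nat_induct_at_least)
  case base
  then show ?case using y1_op_block_weight_vector[OF mod N] by simp
next
  case (Suc k)
  have k: "k \<in> {1..n}" "Suc k \<in> {1..n}" using Suc by auto
  \<comment> \<open>The recursion for \<open>y_op\<close> matches on two successors.\<close>
  then obtain j where j: "k = Suc j" using not0_implies_Suc by fastforce
  let ?\<tau> = "transpose k (Suc k)"
  let ?v = "swap_factors k (Suc k) v"
  have w: "w \<circ> ?\<tau> \<in> words N n" using words_transpose[OF k] Suc by blast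
  have cancel: "w \<circ> ?\<tau> \<circ> ?\<tau> = w" by (simp add: comp_assoc)
  have "mixed_casimir N \<rho> k ?v (w \<circ> ?\<tau>) = mixed_casimir N \<rho> (Suc k) v w"
  proof -
    have "(w \<circ> ?\<tau>)(k := s) \<circ> ?\<tau> = w(Suc k := s)" for s
      by (auto simp: fun_eq_iff transpose_def)
    then show ?thesis by (simp add: mixed_casimir_def swap_factors_def)
  qed
  moreover have "(\<Sum>l=1..<k. ?v (w \<circ> ?\<tau> \<circ> transpose l k)) = (\<Sum>l=1..<k. v (w \<circ> transpose l (Suc k)))"
  proof (rule sum.cong[OF refl])
    fix l assume "l \<in> {1..<k}"
    then have "w \<circ> ?\<tau> \<circ> transpose l k \<circ> ?\<tau> = w \<circ> transpose l (Suc k)"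
      by (auto simp: fun_eq_iff transpose_def)
    then show "?v (w \<circ> ?\<tau> \<circ> transpose l k) = v (w \<circ> transpose l (Suc k))"
      by (simp add: swap_factors_def)
  qed
  moreover have "y_op scale p q n \<mu> \<rho> k ?v (w \<circ> ?\<tau>)
    = scale (K + (\<mu> * of_nat q - \<mu> * of_nat p) / 2 - of_nat N / 2) (?v (w \<circ> ?\<tau>))
      - (mixed_casimir N \<rho> k ?v (w \<circ> ?\<tau>) + (\<Sum>l=1..<k. ?v (w \<circ> ?\<tau> \<circ> transpose l k)))"
    using k Suc by (intro Suc.IH w block_weight_vector_swap) auto
  moreover have "?v (w \<circ> ?\<tau>) = v w" using cancel by (simp add: swap_factors_def)
  moreover have "y_op scale p q n \<mu> \<rho> (Suc k) v w
     = y_op scale p q n \<mu> \<rho> k ?v (w \<circ> ?\<tau>) - v (w \<circ> ?\<tau>)"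
    by (simp add: j swap_factors_def)
  moreover have "(\<Sum>l=1..<Suc k. v (w \<circ> transpose l (Suc k)))
      = (\<Sum>l=1..<k. v (w \<circ> transpose l (Suc k))) + v (w \<circ> ?\<tau>)"
    using k by simp
  ultimately show ?case by (simp only: diff_diff_add add.assoc)
qed

section \<open>Adding a box to a shape\<close>

lemma partial_shape_0:
  assumes "xi 0 = 0"
  shows "partial_shape xi T 0 = xi"
proof
  fix i
  have "{j. (i, j) \<in> diagram xi} = {1..xi i}" using assms by (cases "i = 0") (auto simp: diagram_def)
  then show "partial_shape xi T 0 i = xi i" by (simp add: partial_shape_def row_lengths_def)
qed

text \<open>
  As the tableau increases along rows, the box of \<open>k + 1\<close> is added at the end of its row of the
  shape occupied by \<open>1, \<dots>, k\<close>.
\<close>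

lemma partial_shape_Suc:
  assumes nu: "partition_at_most N nu"
    and T: "T \<in> standard_tableaux n (skew_diagram nu xi)" and k: "Suc k \<le> n"
    and Tk: "T (Suc k) = (i, j)"
  shows "1 \<le> i" "i \<le> N" "1 \<le> j" "partial_shape xi T k i = j - 1"
    "partial_shape xi T (Suc k) = (partial_shape xi T k)(i := j)"
proof -
  have bij: "bij_betw T {1..n} (skew_diagram nu xi)"
    using T by (simp add: standard_tableaux_def)
  have rows: "l < m"
    if "l \<in> {1..n}" "m \<in> {1..n}" "fst (T l) = fst (T m)" "snd (T l) < snd (T m)" for l m
    using T that unfolding standard_tableaux_def by blast
  have "T (Suc k) \<in> skew_diagram nu xi" using bij_betw_apply[OF bij] k by simp
  then have ij: "xi i < j" "j \<le> nu i" by (simp_all add: Tk skew_diagram_def)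
  show "1 \<le> i"
  proof (rule ccontr)
    assume "\<not> 1 \<le> i"
    then have "i = 0" by simp
    with ij nu show False by (simp add: partition_at_most_def)
  qed
  show "i \<le> N" using ij nu unfolding partition_at_most_def by (metis gr_zeroI le_zero_eq not_le not_less_zero)
  show "1 \<le> j" using ij by simp
  have row: "{j'. (i, j') \<in> diagram xi \<union> T ` {1..m}} = {1..if m = k then j - 1 else j}"
    if m: "m = k \<or> m = Suc k" for m
  proof -
    have "(i, j') \<in> T ` {1..m} \<longleftrightarrow> xi i < j' \<and> j' \<le> (if m = k then j - 1 else j)" for j'
    proof
      assume "(i, j') \<in> T ` {1..m}"
      then obtain l where l: "l \<in> {1..m}" "T l = (i, j')" by (metis imageE)
      have ln: "l \<in> {1..n}" using l m k by auto
      then have "T l \<in> skew_diagram nu xi" using bij_betw_apply[OF bij] by blast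
      then have "xi i < j'" using l by (simp add: skew_diagram_def)
      moreover have "\<not> j < j'" using rows[of "Suc k" l] ln k l m Tk by auto
      moreover have "j' \<noteq> j" if "m = k"
        using inj_onD[OF bij_betw_imp_inj_on[OF bij], of l "Suc k"] l ln Tk k that by auto
      ultimately show "xi i < j' \<and> j' \<le> (if m = k then j - 1 else j)" by auto
    next
      assume j': "xi i < j' \<and> j' \<le> (if m = k then j - 1 else j)"
      then have "(i, j') \<in> skew_diagram nu xi" using ij by (auto simp: skew_diagram_def split: if_splits)
      then have "(i, j') \<in> T ` {1..n}" unfolding bij_betw_imp_surj_on[OF bij] .
      then obtain l where l: "l \<in> {1..n}" "T l = (i, j')" by (metis imageE)
      have "l < Suc k" if "j' < j" using rows[of l "Suc k"] l k Tk that by simp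
      moreover have "l = Suc k" if "j' = j"
        using inj_onD[OF bij_betw_imp_inj_on[OF bij], of l "Suc k"] l Tk k that by simp
      ultimately have "l \<in> {1..m}" using j' l m ij by (cases "j' < j") (auto split: if_splits)
      with l(2) show "(i, j') \<in> T ` {1..m}" by (metis imageI)
    qed
    then show ?thesis using ij \<open>1 \<le> i\<close> by (auto simp: diagram_def)
  qed
  show ik: "partial_shape xi T k i = j - 1"
    unfolding partial_shape_def row_lengths_def row[OF disjI1[OF refl]] by simp
  have iSk: "partial_shape xi T (Suc k) i = j"
    unfolding partial_shape_def row_lengths_def row[OF disjI2[OF refl]] by simp
  have "{1..Suc k} = insert (Suc k) {1..k}" by auto
  then have "partial_shape xi T (Suc k) i' = partial_shape xi T k i'" if "i' \<noteq> i" for i'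
    using that by (simp add: partial_shape_def row_lengths_def Tk)
  with iSk show "partial_shape xi T (Suc k) = (partial_shape xi T k)(i := j)" by auto
qed

lemma casimir_value_add_box:
  assumes "1 \<le> i" "i \<le> N" "1 \<le> j" "lam i = j - 1"
  shows "casimir_value N (lam(i := j)) - casimir_value N lam
    = of_nat N + 2 * (of_nat j - of_nat i)"
proof -
  let ?t = "\<lambda>l i. of_nat l * (of_nat l + of_nat N + 1 - 2 * of_nat i) :: complex"
  have "casimir_value N (lam(i := j)) - casimir_value N lam
      = (\<Sum>i'=1..N. if i' = i then ?t j i - ?t (lam i) i else 0)"
    unfolding casimir_value_def sum_subtractf[symmetric] by (intro sum.cong) auto
  also have "\<dots> = ?t j i - ?t (lam i) i" using assms by simp
  also have "\<dots> = of_nat N + 2 * (of_nat j - of_nat i)"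
    using assms by (simp add: of_nat_diff algebra_simps)
  finally show ?thesis .
qed

section \<open>The eigenvalues\<close>

theorem theorem6p3:
  fixes scale :: "complex \<Rightarrow> 'm::ab_group_add \<Rightarrow> 'm"
    and \<rho> :: "complex mat \<Rightarrow> 'm \<Rightarrow> 'm"
    and V\<xi> :: "'m set"
    and n p q N a b :: nat
    and \<mu> \<ss> :: complex
    and \<xi> :: "nat \<Rightarrow> nat"
    and T :: "nat \<Rightarrow> nat \<times> nat"
    and v\<^sub>T :: "(nat \<Rightarrow> nat) \<Rightarrow> 'm"
  assumes "n \<ge> 1" and "1 \<le> p" and "p \<le> q" and "N = p + q"
    and "partition_at_most N \<xi>"
    and "of_nat a = \<mu> * of_nat q + of_nat (psize N \<xi> + n) / of_nat N"
    and "of_nat b = - \<mu> * of_nat p + of_nat (psize N \<xi> + n) / of_nat N"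
    and "highest_weight_irrep scale N \<rho> V\<xi> \<xi>"
    and "T \<in> Tab p q n a b \<xi>"
    and "v\<^sub>T \<in> tableau_line scale p q n \<mu> \<rho> V\<xi> \<xi> T" and "v\<^sub>T \<noteq> 0"
    and "\<ss> = of_nat (psize N \<xi> + n) / of_nat N + (\<mu> * of_nat q - \<mu> * of_nat p) / 2 - of_nat N / 2"
  shows "\<forall>k\<in>{1..n}.
    is_eigenvector (fscale scale) (y_op scale p q n \<mu> \<rho> k) v\<^sub>T (- of_int (cont T k) + \<ss>)"
proof
  fix k assume k: "k \<in> {1..n}"
  note N = assms(4) and hw = assms(8)
  let ?v = "v\<^sub>T"
  let ?K = "(of_nat (psize N \<xi>) + of_nat n) / of_nat N :: complex"
  have mod: "gl_module scale N \<rho> V\<xi>"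
    using hw by (simp add: highest_weight_irrep_def irreducible_gl_module_def)
  interpret gl_module scale N \<rho> V\<xi> by fact
  have F: "?v \<in> F_space scale p q n \<mu> \<rho> V\<xi>"
    and iso: "\<And>k. k \<in> {1..n} \<Longrightarrow> ?v \<in> extend_subspace N k n V\<xi>
      (isotypic_component (fscale scale) N (tensor_act scale N k \<rho>) (tensor_space N k V\<xi>) (partial_shape \<xi> T k))"
    using assms(10) N by (simp_all add: tableau_line_def)
  have bw: "block_weight_vector scale N n \<rho> V\<xi> p
      (\<lambda>s. (if s < p then \<mu> * of_nat q else - \<mu> * of_nat p) + ?K) ?v"
    using assms(2) by (intro F_space_block_weight_vector[OF mod N _ identity_highest_weight_irrep[OF hw] F]) (simp_all add: N)
  then have vT: "?v \<in> tensor_space N n V\<xi>" by (simp add: block_weight_vector_def)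
  obtain nu where nu: "partition_at_most N nu" and T: "T \<in> standard_tableaux n (skew_diagram nu \<xi>)"
    using assms(9) N by (auto simp: Tab_def admissible_shape_def)
  \<comment> \<open>For \<open>l = 0\<close> the shape is \<open>\<xi>\<close> itself, and \<open>V\<xi>\<close> is a copy of \<open>V\<^sup>\<xi>\<close>.\<close>
  have casimir_shape: "partial_casimir l ?v w = scale (casimir_value N (partial_shape \<xi> T l)) (?v w)"
    if "l \<le> n" "w \<in> words N n" for l w
  proof (cases "l = 0")
    case True
    have "partial_shape \<xi> T 0 = \<xi>" using assms(5) by (intro partial_shape_0) (simp add: partition_at_most_def)
    then show ?thesis
      using True casimir_highest_weight_irrep[OF hw tensor_space_memD[OF vT that(2)]]
      by (simp add: partial_casimir_def)
  next
    case False
    then show ?thesis using partial_casimir_extend_subspace[OF that] iso[of l] that by auto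
  qed
  obtain m where m: "k = Suc m" using k not0_implies_Suc by fastforce
  obtain i j where Tk: "T (Suc m) = (i, j)" by fastforce
  have shape: "casimir_value N (partial_shape \<xi> T k)
      = casimir_value N (partial_shape \<xi> T m) + (of_nat N + 2 * of_int (cont T k))"
    using partial_shape_Suc[OF nu T _ Tk] k
      casimir_value_add_box[of i N j "partial_shape \<xi> T m"]
    by (simp add: m cont_def Tk algebra_simps)
  have jm: "mixed_casimir N \<rho> k ?v w + (\<Sum>l=1..<k. ?v (w \<circ> transpose l k))
      = scale (of_int (cont T k)) (?v w)" if w: "w \<in> words N n" for w
  proof -
    let ?Y = "mixed_casimir N \<rho> k ?v w + (\<Sum>l=1..<k. ?v (w \<circ> transpose l k))"
    have "{1..<k} = {1..m}" using m by auto
    then have "partial_casimir k ?v w = partial_casimir m ?v w + scale 2 ?Y + scale (of_nat N) (?v w)"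
      using partial_casimir_Suc[of m ?v w] by (simp add: m)
    moreover have "partial_casimir k ?v w = scale (casimir_value N (partial_shape \<xi> T k)) (?v w)"
      "partial_casimir m ?v w = scale (casimir_value N (partial_shape \<xi> T m)) (?v w)"
      using k m w by (auto intro: casimir_shape)
    ultimately have "scale 2 ?Y = scale 2 (scale (of_int (cont T k)) (?v w))"
      unfolding shape by (simp add: scale_left_distrib)
    then show ?thesis by (simp only: scale_cancel_left) simp
  qed
  have "y_op scale p q n \<mu> \<rho> k ?v w = scale (- of_int (cont T k) + \<ss>) (?v w)" for w
  proof (cases "w \<in> words N n")
    case True
    have s: "\<ss> = ?K + (\<mu> * of_nat q - \<mu> * of_nat p) / 2 - of_nat N / 2" using assms(12) by simp
    have "y_op scale p q n \<mu> \<rho> k ?v w = scale \<ss> (?v w) - scale (of_int (cont T k)) (?v w)"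
      using y_op_block_weight_vector[OF mod N _ _ bw True, of k] k
      unfolding jm[OF True] s by simp
    then show ?thesis by (simp add: scale_left_diff_distrib)
  next
    case False
    then show ?thesis
      using y_op_outside[OF vector_space_axioms, of k n ?v p q V\<xi> w] k vT N
      by (simp add: tensor_space_outside)
  qed
  then show "is_eigenvector (fscale scale) (y_op scale p q n \<mu> \<rho> k) ?v (- of_int (cont T k) + \<ss>)"
    using assms(11) by (simp add: is_eigenvector_def fscale_def fun_eq_iff)
qed

end
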